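(* Let $G$ be a $\mathbb{Z}^d$-gain graph. Then either every generic $d$-dimensional realization $(G,p,L)$ of $G$ is fixed-lattice globally rigid, or every generic $d$-dimensional realization $(G,p,L)$ of $G$ is not fixed-lattice globally rigid.
   Context: Fix an integer $d\ge 1$. A $\mathbb{Z}^d$-gain graph $G=(V,E)$ consists of a finite nonempty vertex set $V$ and a finite set $E$ of edges, where an edge is an equivalence class of triples $(u,v,\gamma)\in V\times V\times\mathbb{Z}^d$ under the identification $(u,v,\gamma)\sim(v,u,-\gamma)$, and triples $(u,u,0)$ are not allowed. A $d$-dimensional realization of $G$ is a $\mathbb{Z}^d$-framework $(G,p,L)$, i.e. a map $p:V\to\mathbb{R}^d$ and an arbitrary real matrix $L\in\mathbb{R}^{d\times d}$ (the lattice). Frameworks $(G,p,L)$ and $(G,q,L')$ are equivalent if $\|p(v)+L\gamma-p(u)\|=\|q(v)+L'\gamma-q(u)\|$ for all $(u,v,\gamma)\in E$, and congruent if there are an orthogonal $d\times d$ matrix $M$ and $x\in\mathbb{R}^d$ with $q(v)=Mp(v)+x$ for all $v\in V$ and $L'=ML$. $(G,p,L)$ is fixed-lattice globally rigid if every $\mathbb{Z}^d$-framework $(G,q,L)$ with the same lattice $L$ that is equivalent to $(G,p,L)$ is congruent to $(G,p,L)$. $(G,p,L)$ is generic if the $d|V|+d^2$ coordinates of $p$ and entries of $L$ are algebraically independent over $\mathbb{Q}$. *)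

theory Defs
  imports "HOL-Analysis.Analysis" "HOL-Library.Poly_Mapping"
begin

text \<open>
  The dimension \<open>d \<ge> 1\<close> is the cardinality of the finite index type \<open>'d\<close>.
\<close>

type_synonym ('v, 'd) gain_triple = "'v \<times> 'v \<times> (int ^ 'd)"

definition gain_triples :: "'v set \<Rightarrow> ('v, 'd::finite) gain_triple set" where
  "gain_triples V = {(u, v, \<gamma>). u \<in> V \<and> v \<in> V \<and> \<not> (u = v \<and> \<gamma> = 0)}"

definition gain_rel :: "'v set \<Rightarrow> (('v, 'd::finite) gain_triple \<times> ('v, 'd) gain_triple) set" where
  "gain_rel V = {((u, v, \<gamma>), t). (u, v, \<gamma>) \<in> gain_triples V \<and>
                   (t = (u, v, \<gamma>) \<or> t = (v, u, - \<gamma>))}"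

lemma equiv_gain_rel: "equiv (gain_triples V) (gain_rel V)"
  by (rule equivI) (auto simp: gain_rel_def gain_triples_def refl_on_def sym_def trans_def)

locale gain_graph =
  fixes V :: "'v set" and E :: "('v, 'd::finite) gain_triple set set"
  assumes finite_vertices: "finite V"
    and vertices_nonempty: "V \<noteq> {}"
    and finite_edges: "finite E"
    and edges: "E \<subseteq> gain_triples V // gain_rel V"

definition gain_vec :: "int ^ 'd \<Rightarrow> real ^ 'd" where
  "gain_vec \<gamma> = (\<chi> i. real_of_int (\<gamma> $ i))"

definition edge_length ::
  "('v \<Rightarrow> real ^ 'd) \<Rightarrow> real ^ 'd ^ 'd \<Rightarrow> ('v, 'd::finite) gain_triple \<Rightarrow> real" where
  "edge_length p L = (\<lambda>(u, v, \<gamma>). norm (p v + L *v gain_vec \<gamma> - p u))"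

lemma edge_length_gain_rel:
  assumes "(s, t) \<in> gain_rel V"
  shows "edge_length p L s = edge_length p L t"
proof -
  have "edge_length p L (u, v, \<gamma>) = edge_length p L (v, u, - \<gamma>)" for u v \<gamma>
  proof -
    have "gain_vec (- \<gamma>) = - gain_vec \<gamma>"
      by (simp add: gain_vec_def vec_eq_iff)
    moreover have "L *v (- x) = - (L *v x)" for x
      by (simp add: matrix_vector_mult_def vec_eq_iff sum_negf)
    ultimately have "p v + L *v gain_vec \<gamma> - p u = - (p u + L *v gain_vec (- \<gamma>) - p v)"
      by simp
    then show ?thesis
      by (simp only: edge_length_def prod.case norm_minus_cancel)
  qed
  with assms show ?thesis
    by (auto simp: gain_rel_def)
qed

text \<open>
  A placement is a total function, but only its values on \<open>V\<close> matter in the notions below.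
\<close>

definition equivalent_frameworks ::
  "('v, 'd::finite) gain_triple set set \<Rightarrow> ('v \<Rightarrow> real ^ 'd) \<Rightarrow> real ^ 'd ^ 'd \<Rightarrow>
   ('v \<Rightarrow> real ^ 'd) \<Rightarrow> real ^ 'd ^ 'd \<Rightarrow> bool" where
  "equivalent_frameworks E p L q L' \<longleftrightarrow>
     (\<forall>e\<in>E. \<forall>t\<in>e. edge_length p L t = edge_length q L' t)"

definition congruent_frameworks ::
  "'v set \<Rightarrow> ('v \<Rightarrow> real ^ 'd) \<Rightarrow> real ^ 'd ^ 'd \<Rightarrow>
   ('v \<Rightarrow> real ^ 'd) \<Rightarrow> real ^ 'd ^ 'd \<Rightarrow> bool" where
  "congruent_frameworks V p L q L' \<longleftrightarrow>
     (\<exists>M x. orthogonal_matrix M \<and> (\<forall>v\<in>V. q v = M *v p v + x) \<and> L' = M ** L)"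

definition fixed_lattice_globally_rigid ::
  "'v set \<Rightarrow> ('v, 'd::finite) gain_triple set set \<Rightarrow>
   ('v \<Rightarrow> real ^ 'd) \<Rightarrow> real ^ 'd ^ 'd \<Rightarrow> bool" where
  "fixed_lattice_globally_rigid V E p L \<longleftrightarrow>
     (\<forall>q. equivalent_frameworks E p L q L \<longrightarrow> congruent_frameworks V p L q L)"

text \<open>
  A multivariate polynomial with rational coefficients and variables indexed by \<open>'i\<close> is a finitely
  supported map from monomials (finitely supported exponent vectors) to coefficients.
\<close>

type_synonym 'i rat_mpoly = "('i \<Rightarrow>\<^sub>0 nat) \<Rightarrow>\<^sub>0 rat"

definition eval_mpoly :: "('i \<Rightarrow> real) \<Rightarrow> 'i rat_mpoly \<Rightarrow> real" where
  "eval_mpoly x P = (\<Sum>m\<in>Poly_Mapping.keys P.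
     of_rat (Poly_Mapping.lookup P m) *
     (\<Prod>i\<in>Poly_Mapping.keys m. x i ^ Poly_Mapping.lookup m i))"

definition mpoly_vars :: "'i rat_mpoly \<Rightarrow> 'i set" where
  "mpoly_vars P = (\<Union>m\<in>Poly_Mapping.keys P. Poly_Mapping.keys m)"

definition algebraically_independent :: "'i set \<Rightarrow> ('i \<Rightarrow> real) \<Rightarrow> bool" where
  "algebraically_independent I x \<longleftrightarrow>
     (\<forall>P. mpoly_vars P \<subseteq> I \<longrightarrow> eval_mpoly x P = 0 \<longrightarrow> P = 0)"

text \<open>
  The index \<open>Inl (v, i)\<close> stands for the \<open>i\<close>-th coordinate of the point of \<open>v\<close>, and \<open>Inr (i, j)\<close> for
  the entry of the lattice matrix in row \<open>i\<close> and column \<open>j\<close>.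
\<close>

definition framework_coords ::
  "('v \<Rightarrow> real ^ 'd) \<Rightarrow> real ^ 'd ^ 'd \<Rightarrow> ('v \<times> 'd) + ('d \<times> 'd) \<Rightarrow> real" where
  "framework_coords p L = case_sum (\<lambda>(v, i). p v $ i) (\<lambda>(i, j). L $ i $ j)"

definition generic_framework ::
  "'v set \<Rightarrow> ('v \<Rightarrow> real ^ 'd) \<Rightarrow> real ^ 'd ^ 'd \<Rightarrow> bool" where
  "generic_framework V p L \<longleftrightarrow>
     algebraically_independent ((V \<times> UNIV) <+> UNIV) (framework_coords p L)"

end

theory Submission
  imports Defs "HOL-Homology.Brouwer_Degree" "HOL-Computational_Algebra.Polynomial"
begin

text \<open>
  A stress of \<open>(p, L)\<close> is a vector \<open>\<omega>\<close> of edge weights in the cokernel of the differential of the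
  edge-length map \<open>f\<close> at \<open>p\<close>; it defines a weighted Laplacian \<open>\<Omega>(\<omega>)\<close> on \<open>V\<close>. The claim follows from the
  criterion that a generic \<open>(p, L)\<close> is rigid iff some stress has \<open>ker \<Omega>(\<omega>)\<close> = constants, because
  existence of such a stress with coordinates in \<open>\<rat>[p, L]\<close> is the same for all generic points.

  Apart from this, genericity enters only through derivations of \<open>\<real>\<close>: since the coordinates are algebraically
  independent, there is a derivation \<open>D\<close> with \<open>D L = 0\<close> and \<open>D p\<close> arbitrary.

  If \<open>ker \<Omega>(\<omega>)\<close> is trivial and \<open>f(q) = f(p)\<close>, applying derivations to this equation shows that \<open>\<omega>\<close> is
  also a stress of \<open>q\<close>; hence \<open>q - p\<close> lies in \<open>ker \<Omega>(\<omega>)\<close>, i.e. \<open>q\<close> is a translate of \<open>p\<close>.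

  If all such kernels are nontrivial, take \<open>\<omega>\<close> with \<open>ker \<Omega>(\<omega>)\<close> as small as possible and let \<open>Z\<close> be the
  displacements with all coordinates in \<open>ker \<Omega>(\<omega>)\<close>. On \<open>Z\<close> one has \<open>f(p + z) - f(p) = 2 R z + \<beta>(z)\<close>
  with \<open>R\<close> linear and \<open>\<beta>(z)\<close> the vector of squared lengths of \<open>z\<close> along the edges, and, by
  differentiating the stress equation, \<open>\<beta>(Z)\<close> is contained in \<open>R(Z)\<close>. A topological argument yields
  \<open>z\<close> in \<open>Z\<close> with \<open>\<beta>(z) = \<lambda> R z \<noteq> 0\<close> and \<open>\<lambda> > 0\<close>, and \<open>p - (2/\<lambda>) z\<close> is then equivalent but not
  congruent to \<open>p\<close>.
\<close>

section \<open>Linear algebra over finite index sets\<close>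

text \<open>Induction on the vectors \<open>a j\<close>. If \<open>\<eta>\<close> separates
  \<open>b\<close> from the old ones but not from \<open>a l\<close>, it no longer obstructs
  \<open>b - (1 / r) * a l\<close>, on which it vanishes. An obstruction \<open>\<theta>\<close> to
  that vector becomes one to \<open>b\<close> after subtracting the multiple of
  \<open>\<eta>\<close> that makes it orthogonal to \<open>a l\<close>.\<close>

lemma Fredholm_alternative:
  fixes a :: "'j \<Rightarrow> 'i \<Rightarrow> real"
  assumes "finite J" "finite I"
  shows "(\<exists>c. \<forall>i\<in>I. b i = (\<Sum>j\<in>J. c j * a j i)) \<or>
         (\<exists>\<eta>. (\<forall>j\<in>J. (\<Sum>i\<in>I. \<eta> i * a j i) = 0) \<and> (\<Sum>i\<in>I. \<eta> i * b i) = 1)"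
  using assms(1)
proof (induction J arbitrary: b rule: finite_induct)
  case empty
  show ?case
  proof (cases "\<forall>i\<in>I. b i = 0")
    case False
    then obtain k where k: "k \<in> I" "b k \<noteq> 0" by blast
    have "(\<Sum>i\<in>I. (if i = k then 1 / b k else 0) * b i) = 1"
      using k assms(2) by (simp add: if_distrib[of "\<lambda>x. x * _"] sum.delta cong: if_cong)
    then show ?thesis by auto
  qed auto
next
  case (insert l J)
  have ext: "\<exists>c'. \<forall>i\<in>I. b i = (\<Sum>j\<in>insert l J. c' j * a j i)"
    if "\<forall>i\<in>I. b i - r * a l i = (\<Sum>j\<in>J. c j * a j i)" for c r b
    using that insert.hyps
    by (intro exI[of _ "c(l := r)"]) (auto simp: algebra_simps intro!: sum.cong)
  consider c where "\<forall>i\<in>I. b i = (\<Sum>j\<in>J. c j * a j i)"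
    | \<eta> where "\<forall>j\<in>J. (\<Sum>i\<in>I. \<eta> i * a j i) = 0" "(\<Sum>i\<in>I. \<eta> i * b i) = 1"
    using insert.IH[of b] by blast
  then show ?case
  proof cases
    case (1 c)
    then show ?thesis using ext[of b 0 c] by auto
  next
    case (2 \<eta>)
    define r where "r = (\<Sum>i\<in>I. \<eta> i * a l i)"
    show ?thesis
    proof (cases "r = 0")
      case True
      then show ?thesis using 2 by (auto simp: r_def)
    next
      case False
      consider c where "\<forall>i\<in>I. b i - (1 / r) * a l i = (\<Sum>j\<in>J. c j * a j i)"
        | \<theta> where "\<forall>j\<in>J. (\<Sum>i\<in>I. \<theta> i * a j i) = 0" "(\<Sum>i\<in>I. \<theta> i * (b i - (1 / r) * a l i)) = 1"
        using insert.IH[of "\<lambda>i. b i - (1 / r) * a l i"] by blast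
      then show ?thesis
      proof cases
        case (1 c)
        then show ?thesis using ext by blast
      next
        case th: (2 \<theta>)
        define s where "s = (\<Sum>i\<in>I. \<theta> i * a l i) / r"
        have eq: "(\<Sum>i\<in>I. (\<theta> i - s * \<eta> i) * y i) = (\<Sum>i\<in>I. \<theta> i * y i) - s * (\<Sum>i\<in>I. \<eta> i * y i)" for y
          by (simp add: algebra_simps sum_subtractf sum_distrib_left)
        have "(\<Sum>i\<in>I. (\<theta> i - s * \<eta> i) * b i) = 1"
          unfolding eq 2(2) using th(2) False
          by (simp add: s_def algebra_simps sum_subtractf sum_divide_distrib)
        moreover have "\<forall>j\<in>insert l J. (\<Sum>i\<in>I. (\<theta> i - s * \<eta> i) * a j i) = 0"
          unfolding eq using 2(1) th(1) False by (auto simp: s_def r_def[symmetric])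
        ultimately show ?thesis
          by (intro disjI2 exI[of _ "\<lambda>i. \<theta> i - s * \<eta> i"] conjI)
      qed
    qed
  qed
qed

lemma solvable_if_orthogonal:
  fixes a :: "'j \<Rightarrow> 'i \<Rightarrow> real"
  assumes "finite J" "finite I"
    and "\<And>\<eta>. (\<And>j. j \<in> J \<Longrightarrow> (\<Sum>i\<in>I. \<eta> i * a j i) = 0) \<Longrightarrow> (\<Sum>i\<in>I. \<eta> i * b i) = 0"
  shows "\<exists>c. \<forall>i\<in>I. b i = (\<Sum>j\<in>J. c j * a j i)"
  using Fredholm_alternative[OF assms(1,2), of b a]
proof (elim disjE exE conjE)
  fix \<eta> assume "\<forall>j\<in>J. (\<Sum>i\<in>I. \<eta> i * a j i) = 0" "(\<Sum>i\<in>I. \<eta> i * b i) = 1"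
  with assms(3)[of \<eta>] show ?thesis by simp
qed blast

text \<open>Gaussian elimination: a pivot \<open>a k l\<close> solves equation \<open>k\<close> for
  the unknown \<open>l\<close>, and the reduced system has one equation and one unknown
  less.\<close>

lemma nontrivial_solution_underdetermined:
  fixes a :: "'i \<Rightarrow> 'j \<Rightarrow> real"
  assumes "finite I" "finite J" "card I < card J"
  shows "\<exists>c. (\<exists>j\<in>J. c j \<noteq> 0) \<and> (\<forall>i\<in>I. (\<Sum>j\<in>J. c j * a i j) = 0)"
  using assms
proof (induction I arbitrary: J a rule: finite_induct)
  case empty
  then show ?case by (intro exI[of _ "\<lambda>_. 1"]) (auto simp: card_gt_0_iff)
next
  case (insert k I)
  show ?case
  proof (cases "\<forall>j\<in>J. a k j = 0")
    case True
    then show ?thesis using insert.IH[of J a] insert.prems insert.hyps by auto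
  next
    case False
    then obtain l where l: "l \<in> J" "a k l \<noteq> 0" by blast
    define a' where "a' i j = a i j - a i l * a k j / a k l" for i j
    have "card I < card (J - {l})"
      using insert.prems insert.hyps l by simp
    then obtain c where c: "\<exists>j\<in>J - {l}. c j \<noteq> 0" "\<forall>i\<in>I. (\<Sum>j\<in>J - {l}. c j * a' i j) = 0"
      using insert.IH[of "J - {l}" a'] insert.prems by blast
    define s where "s = (\<Sum>j\<in>J - {l}. c j * a k j) / a k l"
    define c' where "c' = c(l := - s)"
    have sum: "(\<Sum>j\<in>J. c' j * a i j) = (\<Sum>j\<in>J - {l}. c j * a i j) - s * a i l" for i
      using l(1) insert.prems(1) by (simp add: sum.remove[of J l] c'_def)
    have "(\<Sum>j\<in>J. c' j * a i j) = 0" if "i \<in> I" for i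
      using c(2) that
      by (simp add: sum a'_def s_def algebra_simps sum_subtractf sum_distrib_left sum_divide_distrib)
    moreover have "(\<Sum>j\<in>J. c' j * a k j) = 0"
      using l(2) by (simp add: sum s_def)
    moreover have "\<exists>j\<in>J. c' j \<noteq> 0"
      using c(1) by (auto simp: c'_def)
    ultimately show ?thesis by blast
  qed
qed

text \<open>The columns other than some \<open>l\<close> with \<open>r l \<noteq> 0\<close> impose
  fewer than \<open>card J\<close> conditions on \<open>c\<close>; pairing with \<open>r\<close>
  shows that column \<open>l\<close> is then annihilated too.\<close>

lemma left_kernel_if_right_kernel:
  fixes a :: "'j \<Rightarrow> 'j \<Rightarrow> real"
  assumes "finite J" "\<exists>j\<in>J. r j \<noteq> 0" "\<And>i. i \<in> J \<Longrightarrow> (\<Sum>j\<in>J. a i j * r j) = 0"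
  obtains c where "\<exists>i\<in>J. c i \<noteq> 0" "\<And>j. j \<in> J \<Longrightarrow> (\<Sum>i\<in>J. c i * a i j) = 0"
proof -
  obtain l where l: "l \<in> J" "r l \<noteq> 0" using assms(2) by blast
  have "card (J - {l}) < card J"
    using assms(1) l by (meson card_Diff1_less)
  then obtain c where c: "\<exists>i\<in>J. c i \<noteq> 0" "\<forall>j\<in>J - {l}. (\<Sum>i\<in>J. c i * a i j) = 0"
    using nontrivial_solution_underdetermined[of "J - {l}" J "\<lambda>j i. a i j"] assms(1) by auto
  have "(\<Sum>j\<in>J. (\<Sum>i\<in>J. c i * a i j) * r j) = (\<Sum>i\<in>J. c i * (\<Sum>j\<in>J. a i j * r j))"
    by (simp add: sum_distrib_left sum_distrib_right mult.assoc) (rule sum.swap)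
  also have "\<dots> = 0" using assms(3) by simp
  finally have "(\<Sum>i\<in>J. c i * a i l) * r l = 0"
    using c(2) assms(1) l(1) by (simp add: sum.remove[of J l])
  with l(2) have "(\<Sum>i\<in>J. c i * a i l) = 0" by simp
  with c show ?thesis by (intro that[of c]) blast+
qed

text \<open>Injectivity gives a left inverse \<open>c\<close> of \<open>a\<close>, which turns the
  perturbed system into \<open>y = - t m y\<close> with \<open>m = c b\<close>. For small
  \<open>t\<close> the right side is a contraction in the maximum norm.\<close>

lemma injective_perturbation:
  fixes a b :: "'i \<Rightarrow> 'j \<Rightarrow> real"
  assumes "finite I" "finite J"
    and inj: "\<And>y. (\<And>i. i \<in> I \<Longrightarrow> (\<Sum>j\<in>J. y j * a i j) = 0) \<Longrightarrow> \<forall>j\<in>J. y j = 0"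
  obtains e where "e > 0"
    "\<And>t y. \<bar>t\<bar> < e \<Longrightarrow> (\<And>i. i \<in> I \<Longrightarrow> (\<Sum>j\<in>J. y j * (a i j + t * b i j)) = 0) \<Longrightarrow> \<forall>j\<in>J. y j = 0"
proof -
  have "\<exists>c. \<forall>j\<in>J. (if j = k then 1 else 0) = (\<Sum>i\<in>I. c i * a i j)" if "k \<in> J" for k
  proof -
    have orth: "(\<Sum>j\<in>J. \<eta> j * (if j = k then 1 else 0)) = 0"
      if \<eta>: "\<And>i. i \<in> I \<Longrightarrow> (\<Sum>j\<in>J. \<eta> j * a i j) = 0" for \<eta>
      using inj[OF \<eta>] by simp
    show ?thesis by (rule solvable_if_orthogonal[OF assms(1,2)]) (rule orth)
  qed
  then have "\<forall>k\<in>J. \<exists>c. \<forall>j\<in>J. (if j = k then 1 else 0) = (\<Sum>i\<in>I. c i * a i j)"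
    by blast
  from bchoice[OF this] obtain c where
    c: "\<And>k j. k \<in> J \<Longrightarrow> j \<in> J \<Longrightarrow> (if j = k then 1 else 0) = (\<Sum>i\<in>I. c k i * a i j)"
    by blast
  define m where "m k j = (\<Sum>i\<in>I. c k i * b i j)" for k j
  define C where "C = (\<Sum>k\<in>J. \<Sum>j\<in>J. \<bar>m k j\<bar>)"
  have C0: "C \<ge> 0" by (simp add: C_def sum_nonneg)
  show thesis
  proof (rule that[of "1 / (C + 1)"])
    show "1 / (C + 1) > 0" using C0 by simp
  next
    fix t y assume t: "\<bar>t\<bar> < 1 / (C + 1)"
      and y: "\<And>i. i \<in> I \<Longrightarrow> (\<Sum>j\<in>J. y j * (a i j + t * b i j)) = 0"
    have key: "y k = - t * (\<Sum>j\<in>J. m k j * y j)" if k: "k \<in> J" for k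
    proof -
      have "0 = (\<Sum>i\<in>I. c k i * (\<Sum>j\<in>J. y j * (a i j + t * b i j)))"
        using y by simp
      also have "\<dots> = (\<Sum>j\<in>J. \<Sum>i\<in>I. c k i * (y j * (a i j + t * b i j)))"
        unfolding sum_distrib_left by (rule sum.swap)
      also have "\<dots> = (\<Sum>j\<in>J. y j * (\<Sum>i\<in>I. c k i * a i j) + t * (m k j * y j))"
        by (simp add: m_def algebra_simps sum.distrib sum_distrib_left)
      also have "\<dots> = (\<Sum>j\<in>J. y j * (if j = k then 1 else 0) + t * (m k j * y j))"
        using c k by (intro sum.cong) auto
      also have "\<dots> = y k + t * (\<Sum>j\<in>J. m k j * y j)"
        using k assms(2)
        by (simp add: sum.distrib sum_distrib_left if_distrib[of "\<lambda>x. _ * x"] cong: if_cong)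
      finally show ?thesis by simp
    qed
    show "\<forall>j\<in>J. y j = 0"
    proof (cases "J = {}")
      case False
      define M where "M = Max ((\<lambda>j. \<bar>y j\<bar>) ` J)"
      have M: "\<bar>y j\<bar> \<le> M" if "j \<in> J" for j
        using that assms(2) by (simp add: M_def)
      have "M \<in> (\<lambda>j. \<bar>y j\<bar>) ` J"
        unfolding M_def using False assms(2) by (intro Max_in) auto
      then obtain k where k: "k \<in> J" "M = \<bar>y k\<bar>" by blast
      have M0: "M \<ge> 0" using k by simp
      have "\<bar>\<Sum>j\<in>J. m k j * y j\<bar> \<le> (\<Sum>j\<in>J. \<bar>m k j\<bar> * M)"
        by (rule order_trans[OF sum_abs]) (auto simp: abs_mult intro!: sum_mono mult_left_mono M)
      also have "\<dots> \<le> C * M"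
        unfolding sum_distrib_right[symmetric] C_def using k assms(2) M0
        by (intro mult_right_mono member_le_sum[of k J "\<lambda>k. \<Sum>j\<in>J. \<bar>m k j\<bar>"]) (auto simp: sum_nonneg)
      finally have "M \<le> \<bar>t\<bar> * (C * M)"
        unfolding k(2) using key[OF k(1)] by (simp add: abs_mult mult_left_mono)
      moreover have "\<bar>t\<bar> * (C * M) \<le> 1 / (C + 1) * (C * M)"
        using t C0 M0 by (intro mult_right_mono) auto
      ultimately have "M * (1 - C / (C + 1)) \<le> 0" by (simp add: algebra_simps)
      moreover have "1 - C / (C + 1) > 0" using C0 by simp
      ultimately have "M \<le> 0" by (metis mult_le_0_iff not_less)
      then have "\<bar>y j\<bar> \<le> 0" if "j \<in> J" for j using M[OF that] by linarith
      then show ?thesis by simp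
    qed simp
  qed
qed

text \<open>By \<open>min\<close> some nonzero member of \<open>W\<close> vanishes at all
  coordinates in \<open>J\<close> except \<open>j\<close>; by \<open>inj\<close> it does not vanish
  at \<open>j\<close>, so it can be scaled to 1 there.\<close>

lemma coordinate_dual_basis:
  fixes W :: "('t \<Rightarrow> real) set"
  assumes scale: "\<And>w r. w \<in> W \<Longrightarrow> (\<lambda>t. r * w t) \<in> W"
    and inj: "\<And>w. w \<in> W \<Longrightarrow> (\<And>j. j \<in> J \<Longrightarrow> w j = 0) \<Longrightarrow> \<forall>t\<in>T. w t = 0"
    and min: "\<And>j. j \<in> J \<Longrightarrow> \<exists>w\<in>W. (\<forall>i\<in>J - {j}. w i = 0) \<and> \<not> (\<forall>t\<in>T. w t = 0)"
  shows "\<exists>b. \<forall>j\<in>J. b j \<in> W \<and> (\<forall>i\<in>J. b j i = (if i = j then 1 else 0))"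
proof (rule bchoice, rule ballI)
  fix j assume j: "j \<in> J"
  obtain w where w: "w \<in> W" "\<forall>i\<in>J - {j}. w i = 0" "\<not> (\<forall>t\<in>T. w t = 0)"
    using min[OF j] by blast
  have "w j \<noteq> 0" using inj[OF w(1)] w(2,3) by (metis DiffI singletonD)
  then show "\<exists>b. b \<in> W \<and> (\<forall>i\<in>J. b i = (if i = j then 1 else 0))"
    using scale[OF w(1), of "1 / w j"] w(2) by (intro exI[of _ "\<lambda>t. 1 / w j * w t"]) auto
qed

text \<open>As few entries of \<open>y\<close> as possible are chosen that express all others over
  the ring \<open>K\<close>, up to a common denominator \<open>d\<close>. They are linearly
  independent over \<open>K\<close>, so every relation among the \<open>y j\<close> with
  coefficients in \<open>K\<close> holds for each column of \<open>c\<close> separately. In effect,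
  real solutions of a linear system over \<open>K\<close> are combinations of solutions in
  \<open>K\<close>.\<close>

lemma linear_descent:
  fixes K :: "real set" and y :: "'j \<Rightarrow> real"
  assumes one: "1 \<in> K" and diff: "\<And>a b. a \<in> K \<Longrightarrow> b \<in> K \<Longrightarrow> a - b \<in> K"
    and mult: "\<And>a b. a \<in> K \<Longrightarrow> b \<in> K \<Longrightarrow> a * b \<in> K"
    and J: "finite J"
  shows "\<exists>L d c. L \<subseteq> J \<and> d \<noteq> 0 \<and> (\<forall>j\<in>J. \<forall>l\<in>L. c j l \<in> K) \<and>
    (\<forall>j\<in>J. d * y j = (\<Sum>l\<in>L. c j l * y l)) \<and>
    (\<forall>a. (\<forall>j\<in>J. a j \<in> K) \<longrightarrow> (\<Sum>j\<in>J. a j * y j) = 0 \<longrightarrow> (\<forall>l\<in>L. (\<Sum>j\<in>J. a j * c j l) = 0))"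
proof -
  define P where "P L d c \<longleftrightarrow> L \<subseteq> J \<and> d \<in> K \<and> d \<noteq> 0 \<and> (\<forall>j\<in>J. \<forall>l\<in>L. c j l \<in> K) \<and>
    (\<forall>j\<in>J. d * y j = (\<Sum>l\<in>L. c j l * y l))" for L d c
  have zero: "0 \<in> K" using diff[OF one one] by simp
  have uminus: "- a \<in> K" if "a \<in> K" for a using diff[OF zero that] by simp
  have add: "a + b \<in> K" if "a \<in> K" "b \<in> K" for a b using diff[OF that(1) uminus[OF that(2)]] by simp
  have sum: "sum f A \<in> K" if "\<And>i. i \<in> A \<Longrightarrow> f i \<in> K" for f and A :: "'j set"
    using that by (induction A rule: infinite_finite_induct) (auto simp: zero add)
  have "P J 1 (\<lambda>j l. if l = j then 1 else 0)"
    using one zero J by (auto simp: P_def if_distrib[of "\<lambda>x. x * _"] cong: if_cong)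
  then have ex: "\<exists>n. \<exists>L d c. P L d c \<and> card L = n" by blast
  define n where "n = (LEAST n. \<exists>L d c. P L d c \<and> card L = n)"
  obtain L d c where P: "P L d c" "card L = n"
    using LeastI_ex[OF ex] unfolding n_def by blast
  have least: "n \<le> card L'" if "P L' d' c'" for L' d' c'
    unfolding n_def by (rule Least_le) (use that in blast)
  have Pd: "d \<in> K" "d \<noteq> 0" "\<And>j l. j \<in> J \<Longrightarrow> l \<in> L \<Longrightarrow> c j l \<in> K"
      "\<And>j. j \<in> J \<Longrightarrow> d * y j = (\<Sum>l\<in>L. c j l * y l)"
    using P(1) unfolding P_def by blast+
  have LJ: "L \<subseteq> J" using P(1) unfolding P_def by blast
  note L = finite_subset[OF LJ J] LJ
  have indep: "\<forall>l\<in>L. f l = 0" if f: "\<And>l. l \<in> L \<Longrightarrow> f l \<in> K" "(\<Sum>l\<in>L. f l * y l) = 0" for f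
  proof (rule ccontr)
    assume "\<not> ?thesis"
    then obtain k where k: "k \<in> L" "f k \<noteq> 0" by blast
    have yk: "f k * y k = - (\<Sum>l\<in>L - {k}. f l * y l)"
      using f(2) L(1) k(1) by (simp add: sum.remove[of L k])
    \<comment> \<open>The relation \<open>f\<close> eliminates \<open>y k\<close>; multiplying by
      \<open>f k\<close> instead of dividing keeps the coefficients in \<open>K\<close>.\<close>
    have "P (L - {k}) (d * f k) (\<lambda>j l. c j l * f k - c j k * f l)"
      unfolding P_def
    proof (intro conjI ballI)
      fix j assume j: "j \<in> J"
      have "(\<Sum>l\<in>L - {k}. (c j l * f k - c j k * f l) * y l) =
          (\<Sum>l\<in>L - {k}. f k * (c j l * y l) - c j k * (f l * y l))"
        by (intro sum.cong) (auto simp: algebra_simps)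
      also have "\<dots> = f k * (\<Sum>l\<in>L - {k}. c j l * y l) - c j k * (\<Sum>l\<in>L - {k}. f l * y l)"
        by (simp only: sum_subtractf sum_distrib_left)
      also have "\<dots> = f k * ((\<Sum>l\<in>L - {k}. c j l * y l) + c j k * y k)"
        using arg_cong[OF yk, of "\<lambda>a. c j k * a"] by (simp only: algebra_simps)
      also have "\<dots> = f k * (d * y j)"
        unfolding Pd(4)[OF j] sum.remove[OF L(1) k(1)] by (simp only: add.commute)
      finally show "d * f k * y j = (\<Sum>l\<in>L - {k}. (c j l * f k - c j k * f l) * y l)"
        by simp
    next
      show "L - {k} \<subseteq> J" "d * f k \<in> K" "d * f k \<noteq> 0" using L(2) Pd(1,2) k f(1) mult by auto
      show "c j l * f k - c j k * f l \<in> K" if "j \<in> J" "l \<in> L - {k}" for j l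
        using that k(1) by (intro diff mult Pd(3) f(1)) auto
    qed
    from least[OF this] have "n \<le> card (L - {k})" .
    with P(2) card_Diff1_less[OF L(1) k(1)] show False by simp
  qed
  have rel: "\<forall>l\<in>L. (\<Sum>j\<in>J. a j * c j l) = 0"
    if a: "\<forall>j\<in>J. a j \<in> K" "(\<Sum>j\<in>J. a j * y j) = 0" for a
  proof (rule indep)
    show "(\<Sum>j\<in>J. a j * c j l) \<in> K" if l: "l \<in> L" for l
      using l a(1) by (intro sum mult Pd(3)) auto
    have "(\<Sum>l\<in>L. (\<Sum>j\<in>J. a j * c j l) * y l) = (\<Sum>j\<in>J. a j * (\<Sum>l\<in>L. c j l * y l))"
      by (simp add: sum_distrib_left sum_distrib_right mult.assoc) (rule sum.swap)
    also have "\<dots> = (\<Sum>j\<in>J. a j * (d * y j))"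
      by (intro sum.cong refl) (simp only: Pd(4))
    also have "\<dots> = d * (\<Sum>j\<in>J. a j * y j)"
      by (simp add: sum_distrib_left mult_ac)
    finally show "(\<Sum>l\<in>L. (\<Sum>j\<in>J. a j * c j l) * y l) = 0" using a(2) by simp
  qed
  show ?thesis
    using LJ Pd(2,3,4) rel by (intro exI[of _ L] exI[of _ d] exI[of _ c] conjI ballI allI impI) blast+
qed

section \<open>Eigenvectors of nonnegative maps\<close>

lemma nsphere_eq_top_of_set:
  "nsphere n = top_of_set {x. (\<Sum>i\<le>n. (x i)\<^sup>2) = 1 \<and> (\<forall>i>n. x i = 0)}"
  unfolding nsphere euclidean_product_topology by (simp only: Collect_conj_eq Int_commute)

text \<open>Radial projection to the unit sphere. Coordinates beyond \<open>n\<close> are set to 0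
  because \<open>nsphere n\<close> consists of sequences of that form.\<close>

definition sphere_normalize :: "nat \<Rightarrow> (nat \<Rightarrow> real) \<Rightarrow> nat \<Rightarrow> real" where
  "sphere_normalize n x i = (if i \<le> n then x i / sqrt (\<Sum>j\<le>n. (x j)\<^sup>2) else 0)"

text \<open>A homotopy through nowhere vanishing maps survives radial projection: \<open>nz\<close>
  keeps the norm in the denominator positive.\<close>

lemma homotopic_normalized_sphere_maps:
  fixes h :: "real \<Rightarrow> (nat \<Rightarrow> real) \<Rightarrow> nat \<Rightarrow> real"
  assumes cont: "\<And>i. i \<le> n \<Longrightarrow> continuous_on UNIV (\<lambda>(t, x). h t x i)"
    and nz: "\<And>t x. 0 \<le> t \<Longrightarrow> t \<le> 1 \<Longrightarrow> x \<in> topspace (nsphere n) \<Longrightarrow> \<exists>i\<le>n. h t x i \<noteq> 0"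
  shows "homotopic_with (\<lambda>_. True) (nsphere n) (nsphere n) (\<lambda>x. sphere_normalize n (h 0 x)) (\<lambda>x. sphere_normalize n (h 1 x))"
proof -
  define S where "S = {x :: nat \<Rightarrow> real. (\<Sum>i\<le>n. (x i)\<^sup>2) = 1 \<and> (\<forall>i>n. x i = 0)}"
  have top: "topspace (nsphere n) = S" by (simp add: nsphere_eq_top_of_set S_def)
  have pos: "(\<Sum>j\<le>n. (h t x j)\<^sup>2) > 0" if tx: "0 \<le> t" "t \<le> 1" "x \<in> S" for t x
  proof -
    obtain i where "i \<le> n" "h t x i \<noteq> 0" using nz[OF tx(1,2), of x] tx(3) top by blast
    then show ?thesis by (intro sum_pos2[of _ i]) auto
  qed
  have "continuous_on ({0..1} \<times> S) (\<lambda>z. sphere_normalize n (h (fst z) (snd z)))"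
  proof (rule continuous_on_coordinatewise_then_product)
    fix i
    have c: "continuous_on ({0..1} \<times> S) (\<lambda>z. h (fst z) (snd z) j)" if "j \<le> n" for j
      using continuous_on_subset[OF cont[OF that] subset_UNIV] by (simp add: case_prod_unfold)
    show "continuous_on ({0..1} \<times> S) (\<lambda>z. sphere_normalize n (h (fst z) (snd z)) i)"
    proof (cases "i \<le> n")
      case True
      have "sqrt (\<Sum>j\<le>n. (h (fst z) (snd z) j)\<^sup>2) \<noteq> 0" if "z \<in> {0..1} \<times> S" for z
        using pos[of "fst z" "snd z"] that by auto
      then show ?thesis unfolding sphere_normalize_def using True
        by (auto intro!: continuous_intros c)
    qed (simp add: sphere_normalize_def)
  qed
  moreover have "sphere_normalize n (h t x) \<in> S" if "0 \<le> t" "t \<le> 1" "x \<in> S" for t x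
    using pos[OF that] by (simp add: sphere_normalize_def S_def power_divide sum_divide_distrib[symmetric])
  ultimately show ?thesis
    unfolding nsphere_eq_top_of_set S_def[symmetric] homotopic_with_def prod_topology_subtopology_eu
    by (intro exI[of _ "\<lambda>z. sphere_normalize n (h (fst z) (snd z))"]) 
      (simp add: continuous_map_subtopology_eu Pi_iff split_beta)
qed

text \<open>
  Without a positive eigenvalue the identity of the sphere would be homotopic to \<open>- \<phi> / \<parallel>\<phi>\<parallel>\<close>, which
  misses the positive orthant and is therefore nullhomotopic.
\<close>

lemma nonneg_map_eigenvector:
  fixes \<phi> :: "(nat \<Rightarrow> real) \<Rightarrow> nat \<Rightarrow> real"
  assumes cont: "\<And>i. i \<le> n \<Longrightarrow> continuous_on UNIV (\<lambda>x. \<phi> x i)"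
    and nonneg: "\<And>x i. i \<le> n \<Longrightarrow> \<phi> x i \<ge> 0"
    and nz: "\<And>x. \<exists>i\<le>n. x i \<noteq> 0 \<Longrightarrow> \<exists>i\<le>n. \<phi> x i \<noteq> 0"
  obtains x l where "l > 0" "\<exists>i\<le>n. x i \<noteq> 0" "\<And>i. i \<le> n \<Longrightarrow> \<phi> x i = l * x i"
proof (rule ccontr)
  assume "\<not> thesis"
  with that have no: "\<not> (l > 0 \<and> (\<exists>i\<le>n. x i \<noteq> 0) \<and> (\<forall>i\<le>n. \<phi> x i = l * x i))" for l x
    by blast
  have sph: "(\<Sum>i\<le>n. (x i)\<^sup>2) = 1" "\<And>i. i > n \<Longrightarrow> x i = 0" if "x \<in> topspace (nsphere n)" for x
    using that by (auto simp: nsphere_eq_top_of_set)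
  have snz: "\<exists>i\<le>n. x i \<noteq> 0" if "x \<in> topspace (nsphere n)" for x
  proof (rule ccontr)
    assume "\<not> ?thesis"
    then have "(\<Sum>i\<le>n. (x i)\<^sup>2) = 0" by simp
    with sph[OF that] show False by simp
  qed
  have c: "continuous_on UNIV (\<lambda>z :: real \<times> (nat \<Rightarrow> real). \<phi> (snd z) i)" if "i \<le> n" for i
    by (rule continuous_on_compose2[OF cont[OF that]]) (auto intro: continuous_intros)
  have c': "continuous_on UNIV (\<lambda>z :: real \<times> (nat \<Rightarrow> real). snd z i)" for i
    by (rule continuous_on_product_then_coordinatewise) (auto intro: continuous_intros)
  \<comment> \<open>The segment from \<open>x\<close> to \<open>- \<phi> x\<close> avoids 0: a zero
    at an inner time \<open>t\<close> would be an eigenvector with eigenvalue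
    \<open>(1 - t) / t > 0\<close>.\<close>
  have 1: "homotopic_with (\<lambda>_. True) (nsphere n) (nsphere n)
      (\<lambda>x. sphere_normalize n (\<lambda>i. (1 - 0) * x i - 0 * \<phi> x i)) (\<lambda>x. sphere_normalize n (\<lambda>i. (1 - 1) * x i - 1 * \<phi> x i))"
  proof (rule homotopic_normalized_sphere_maps)
    show "continuous_on UNIV (\<lambda>(t, x). (1 - t) * x i - t * \<phi> x i)" if "i \<le> n" for i
      unfolding case_prod_unfold by (intro continuous_intros c c' that)
    fix t :: real and x assume t: "0 \<le> t" "t \<le> 1" and x: "x \<in> topspace (nsphere n)"
    show "\<exists>i\<le>n. (1 - t) * x i - t * \<phi> x i \<noteq> 0"
    proof (rule ccontr)
      assume "\<not> ?thesis"
      then have eq: "(1 - t) * x i = t * \<phi> x i" if "i \<le> n" for i using that by auto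
      consider "t = 0" | "t = 1" | "0 < t" "t < 1" using t by linarith
      then show False
      proof cases
        case 1 then show ?thesis using eq snz[OF x] by auto
      next
        case 2 then show ?thesis using eq nz snz[OF x] by force
      next
        case 3
        then have "\<phi> x i = (1 - t) / t * x i" if "i \<le> n" for i
          using eq[OF that] by (simp add: field_simps)
        moreover have "(1 - t) / t > 0" using 3 by simp
        ultimately show ?thesis using no[of "(1 - t) / t" x] snz[OF x] by blast
      qed
    qed
  qed
  \<comment> \<open>From \<open>- \<phi> x\<close> to the constant vector with entries -1: a
    coordinate where \<open>\<phi> x\<close> is positive stays negative throughout.\<close>
  have 2: "homotopic_with (\<lambda>_. True) (nsphere n) (nsphere n)
      (\<lambda>x. sphere_normalize n (\<lambda>i. - (1 - 0) * \<phi> x i - 0)) (\<lambda>x. sphere_normalize n (\<lambda>i. - (1 - 1) * \<phi> x i - 1))"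
  proof (rule homotopic_normalized_sphere_maps)
    show "continuous_on UNIV (\<lambda>(t, x). - (1 - t) * \<phi> x i - t)" if "i \<le> n" for i
      unfolding case_prod_unfold by (intro continuous_intros c that)
    fix t :: real and x assume t: "0 \<le> t" "t \<le> 1" and x: "x \<in> topspace (nsphere n)"
    obtain i where i: "i \<le> n" "\<phi> x i \<noteq> 0" using nz[OF snz[OF x]] by blast
    then have "\<phi> x i > 0" using nonneg[OF i(1), of x] by simp
    then have "(1 - t) * \<phi> x i + t > 0"
      using t by (cases "t = 0") (auto intro!: add_nonneg_pos)
    moreover have "- (1 - t) * \<phi> x i - t = - ((1 - t) * \<phi> x i + t)"
      by (simp add: algebra_simps)
    ultimately show "\<exists>i\<le>n. - (1 - t) * \<phi> x i - t \<noteq> 0" using i(1) by (metis neg_equal_0_iff_equal less_irrefl)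
  qed
  have "homotopic_with (\<lambda>_. True) (nsphere n) (nsphere n) (\<lambda>x. sphere_normalize n x) (\<lambda>x. sphere_normalize n (\<lambda>i. - 1))"
    using homotopic_with_trans[OF 1] 2 by simp
  then have "homotopic_with (\<lambda>_. True) (nsphere n) (nsphere n) id (\<lambda>x. sphere_normalize n (\<lambda>i. - 1))"
    by (rule homotopic_with_eq) (auto simp: sphere_normalize_def sph fun_eq_iff not_le)
  then show False
    using non_contractible_space_nsphere[of n] unfolding contractible_space_def by blast
qed

section \<open>Derivations of the real numbers\<close>

definition derivation :: "(real \<Rightarrow> real) \<Rightarrow> bool" where
  "derivation D \<longleftrightarrow> (\<forall>a b. D (a + b) = D a + D b) \<and> (\<forall>a b. D (a * b) = a * D b + D a * b)"

text \<open>
  The graph of a derivation of a subring of \<open>\<real>\<close> with values in \<open>\<real>\<close> is a subring of the dual numbers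
  \<open>\<real>[\<epsilon>]\<close> that meets \<open>\<real>\<epsilon>\<close> only in \<open>0\<close>.
\<close>

definition derivation_graph :: "(real \<times> real) set \<Rightarrow> bool" where
  "derivation_graph G \<longleftrightarrow> (1, 0) \<in> G \<and>
     (\<forall>a x. (a, x) \<in> G \<longrightarrow> (- a, - x) \<in> G) \<and>
     (\<forall>a x b y. (a, x) \<in> G \<longrightarrow> (b, y) \<in> G \<longrightarrow> (a + b, x + y) \<in> G) \<and>
     (\<forall>a x b y. (a, x) \<in> G \<longrightarrow> (b, y) \<in> G \<longrightarrow> (a * b, a * y + x * b) \<in> G) \<and>
     (\<forall>x. (0, x) \<in> G \<longrightarrow> x = 0)"

section \<open>Arithmetic in a derivation graph and its extension by one element\<close>

context
  fixes G assumes G: "derivation_graph G"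
begin

lemma graph_one: "(1, 0) \<in> G"
  and graph_uminus: "(a, x) \<in> G \<Longrightarrow> (- a, - x) \<in> G"
  and graph_add: "(a, x) \<in> G \<Longrightarrow> (b, y) \<in> G \<Longrightarrow> (a + b, x + y) \<in> G"
  and graph_mult: "(a, x) \<in> G \<Longrightarrow> (b, y) \<in> G \<Longrightarrow> (a * b, a * y + x * b) \<in> G"
  and graph_zeroD: "(0, x) \<in> G \<Longrightarrow> x = 0"
  using G unfolding derivation_graph_def by blast+

lemma graph_zero: "(0, 0) \<in> G"
  using graph_add[OF graph_one graph_uminus[OF graph_one]] by simp

lemma graph_diff: "(a, x) \<in> G \<Longrightarrow> (b, y) \<in> G \<Longrightarrow> (a - b, x - y) \<in> G"
  using graph_add[OF _ graph_uminus] by fastforce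

lemma graph_sum: "(\<And>i. i \<in> A \<Longrightarrow> (f i, g i) \<in> G) \<Longrightarrow> (sum f A, sum g A) \<in> G"
  by (induction A rule: infinite_finite_induct) (auto simp: graph_zero graph_add)

lemma graph_of_nat: "(of_nat n, 0) \<in> G"
proof (induction n)
  case (Suc n)
  then show ?case using graph_add[OF graph_one] by fastforce
qed (simp add: graph_zero)

text \<open>The graph of the derivation acting on polynomials coefficientwise: \<open>h\<close>
  arises from \<open>g\<close> by differentiating the coefficients.\<close>

definition graph_polys :: "(real poly \<times> real poly) set" where
  "graph_polys = {(g, h). \<forall>i. (poly.coeff g i, poly.coeff h i) \<in> G}"

lemma graph_polysD: "(g, h) \<in> graph_polys \<Longrightarrow> (poly.coeff g i, poly.coeff h i) \<in> G"
  by (simp add: graph_polys_def)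

lemma graph_polys_const: "(a, x) \<in> G \<Longrightarrow> ([:a:], [:x:]) \<in> graph_polys"
  by (simp add: graph_polys_def coeff_pCons graph_zero split: nat.split)

lemma graph_polys_X: "([:0, 1:], 0) \<in> graph_polys"
  by (simp add: graph_polys_def coeff_pCons graph_zero graph_one split: nat.split)

lemma graph_polys_monom: "(a, x) \<in> G \<Longrightarrow> (Polynomial.monom a n, Polynomial.monom x n) \<in> graph_polys"
  by (simp add: graph_polys_def graph_zero)

lemma graph_polys_uminus: "(g, h) \<in> graph_polys \<Longrightarrow> (- g, - h) \<in> graph_polys"
  by (simp add: graph_polys_def graph_uminus)

lemma graph_polys_add:
  "(g, h) \<in> graph_polys \<Longrightarrow> (g', h') \<in> graph_polys \<Longrightarrow> (g + g', h + h') \<in> graph_polys"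
  by (simp add: graph_polys_def graph_add)

lemma graph_polys_diff:
  "(g, h) \<in> graph_polys \<Longrightarrow> (g', h') \<in> graph_polys \<Longrightarrow> (g - g', h - h') \<in> graph_polys"
  by (simp add: graph_polys_def graph_diff)

lemma graph_polys_mult:
  assumes "(g, h) \<in> graph_polys" "(g', h') \<in> graph_polys"
  shows "(g * g', g * h' + h * g') \<in> graph_polys"
  using assms
  by (auto simp: graph_polys_def coeff_mult sum.distrib[symmetric] intro!: graph_sum graph_mult)

lemma graph_polys_pderiv:
  assumes "(g, h) \<in> graph_polys"
  shows "(pderiv g, pderiv h) \<in> graph_polys"
  using graph_mult[OF graph_of_nat graph_polysD[OF assms]]
  by (auto simp: graph_polys_def coeff_pderiv simp del: of_nat_Suc)

lemma graph_polys_zeroD: "(0, h) \<in> graph_polys \<Longrightarrow> h = 0"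
  using graph_zeroD by (auto simp: graph_polys_def poly_eq_iff)

text \<open>
  At a root \<open>a\<close> of \<open>g\<close> the chain rule forces \<open>h(a) + u g'(a) = 0\<close> when \<open>u\<close> is the derivative of \<open>a\<close>;
  division by a polynomial of minimal degree with root \<open>a\<close> shows that one value \<open>u\<close> fits all \<open>g\<close>.
\<close>

lemma graph_polys_root_derivative:
  obtains u where
    "\<And>g h. (g, h) \<in> graph_polys \<Longrightarrow> poly g a = 0 \<Longrightarrow> poly h a + u * poly (pderiv g) a = 0"
proof (cases "\<exists>g h. (g, h) \<in> graph_polys \<and> poly g a = 0 \<and> g \<noteq> 0")
  \<comment> \<open>Here \<open>a\<close> is transcendental over the domain of \<open>G\<close>, so
    only the zero polynomial is tested.\<close>
  case False
  show ?thesis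
  proof (rule that[of 0])
    fix g h assume gh: "(g, h) \<in> graph_polys" "poly g a = 0"
    then have "g = 0" using False by blast
    with gh have "h = 0" using graph_polys_zeroD by blast
    with \<open>g = 0\<close> show "poly h a + 0 * poly (pderiv g) a = 0" by simp
  qed
next
  case True
  define Q where "Q n \<longleftrightarrow> (\<exists>g h. (g, h) \<in> graph_polys \<and> poly g a = 0 \<and> g \<noteq> 0 \<and> Polynomial.degree g = n)" for n
  have "\<exists>n. Q n" using True by (auto simp: Q_def)
  then obtain n where n: "Q n" "\<And>m. m < n \<Longrightarrow> \<not> Q m" using exists_least_iff[of Q] by blast
  then obtain g0 h0 where g0: "(g0, h0) \<in> graph_polys" "poly g0 a = 0" "g0 \<noteq> 0" "Polynomial.degree g0 = n"
    by (auto simp: Q_def)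
  have "n \<noteq> 0"
  proof
    assume "n = 0"
    then obtain c where "g0 = [:c:]" using g0(4) degree_eq_zeroE by blast
    with g0 show False by simp
  qed
  \<comment> \<open>Otherwise the derivative of \<open>g0\<close>, nonzero and of smaller degree,
    would contradict minimality.\<close>
  have p0: "poly (pderiv g0) a \<noteq> 0"
  proof
    assume "poly (pderiv g0) a = 0"
    then have "Q (n - 1)"
      unfolding Q_def using graph_polys_pderiv[OF g0(1)] g0(4) \<open>n \<noteq> 0\<close>
      by (intro exI[of _ "pderiv g0"] exI[of _ "pderiv h0"]) (auto simp: degree_pderiv pderiv_eq_0_iff)
    then show False using n(2) \<open>n \<noteq> 0\<close> by simp
  qed
  define u where "u = - poly h0 a / poly (pderiv g0) a"
  have u0: "poly h0 a + u * poly (pderiv g0) a = 0" using p0 by (simp add: u_def)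
  have "poly h a + u * poly (pderiv g) a = 0" if "(g, h) \<in> graph_polys" "poly g a = 0" for g h
    using that
  proof (induction "Polynomial.degree g" arbitrary: g h rule: less_induct)
    case less
    show ?case
    proof (cases "g = 0")
      case True
      then have "h = 0" using graph_polys_zeroD less.prems(1) by blast
      with True show ?thesis by simp
    next
      case False
      have dg: "Polynomial.degree g0 \<le> Polynomial.degree g"
        using n(2)[of "Polynomial.degree g"] False less.prems g0(4) by (auto simp: Q_def not_less[symmetric])
      define k where "k = Polynomial.degree g - Polynomial.degree g0"
      define c c' l l' where "c = poly.coeff g0 n" and "c' = poly.coeff h0 n"
        and "l = poly.coeff g (Polynomial.degree g)" and "l' = poly.coeff h (Polynomial.degree g)"
      \<comment> \<open>One step of pseudo-division by \<open>g0\<close>, cancelling the leading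
        term without leaving the ring; \<open>h1\<close> is the coefficientwise derivative of
        \<open>g1\<close> computed by the product rule.\<close>
      define g1 where "g1 = [:c:] * g - Polynomial.monom l k * g0"
      define h1 where "h1 = ([:c:] * h + [:c':] * g) - (Polynomial.monom l k * h0 + Polynomial.monom l' k * g0)"
      have cG: "(c, c') \<in> G" and lG: "(l, l') \<in> G"
        using graph_polysD[OF g0(1)] graph_polysD[OF less.prems(1)]
        by (auto simp: c_def c'_def l_def l'_def)
      have gh1: "(g1, h1) \<in> graph_polys"
        unfolding g1_def h1_def
        by (intro graph_polys_diff graph_polys_mult graph_polys_const graph_polys_monom cG lG less.prems g0(1))
      have g1a: "poly g1 a = 0" by (simp add: g1_def g0(2) less.prems(2))
      have "c \<noteq> 0" using g0(3,4) by (auto simp: c_def)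
      have E1: "poly h1 a + u * poly (pderiv g1) a = 0"
      proof (cases "g1 = 0")
        case True
        then have "h1 = 0" using graph_polys_zeroD gh1 by blast
        with True show ?thesis by simp
      next
        case False
        have "Polynomial.degree g1 \<le> Polynomial.degree g"
        proof -
          have "Polynomial.degree (Polynomial.monom l k * g0) \<le> k + Polynomial.degree g0"
            using degree_mult_le[of "Polynomial.monom l k" g0] degree_monom_le[of l k] by linarith
          then show ?thesis unfolding g1_def using dg by (intro degree_diff_le) (auto simp: k_def)
        qed
        moreover have "poly.coeff g1 (Polynomial.degree g) = 0"
          using dg g0(4) by (simp add: g1_def coeff_monom_mult k_def c_def l_def)
        ultimately have "Polynomial.degree g1 < Polynomial.degree g"
          using False by (metis leading_coeff_0_iff le_neq_implies_less)
        then show ?thesis using less.hyps gh1 g1a by blast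
      qed
      have "c * (poly h a + u * poly (pderiv g) a) =
            poly h1 a + u * poly (pderiv g1) a + poly (Polynomial.monom l k) a * (poly h0 a + u * poly (pderiv g0) a)"
        by (simp add: g1_def h1_def pderiv_diff pderiv_mult pderiv_smult g0(2) less.prems(2) algebra_simps)
      then show ?thesis using E1 u0 \<open>c \<noteq> 0\<close> by simp
    qed
  qed
  then show ?thesis using that by blast
qed

text \<open>The ring generated by \<open>a\<close> over the domain consists of the values
  \<open>poly g a\<close>, and the chain rule dictates the derivative of each. That the result is
  single-valued is exactly the property of \<open>u\<close>.\<close>

lemma derivation_graph_extend:
  "\<exists>G' u. derivation_graph G' \<and> G \<subseteq> G' \<and> (a, u) \<in> G'"
proof -
  obtain u where u: "\<And>g h. (g, h) \<in> graph_polys \<Longrightarrow> poly g a = 0 \<Longrightarrow> poly h a + u * poly (pderiv g) a = 0"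
    using graph_polys_root_derivative by blast
  define F where "F = (\<lambda>(g, h). (poly g a, poly h a + u * poly (pderiv g) a))"
  have Fin: "F gh = z \<Longrightarrow> gh \<in> graph_polys \<Longrightarrow> z \<in> F ` graph_polys" for gh z by blast
  have "derivation_graph (F ` graph_polys)"
    unfolding derivation_graph_def
  proof (intro conjI allI impI)
    show "(1, 0) \<in> F ` graph_polys"
      by (rule Fin[OF _ graph_polys_const[OF graph_one]]) (simp add: F_def)
    show "(- b, - x) \<in> F ` graph_polys" if bx: "(b, x) \<in> F ` graph_polys" for b x
    proof -
      obtain g h where "(g, h) \<in> graph_polys" "F (g, h) = (b, x)" using bx by force
      then show ?thesis by (intro Fin[OF _ graph_polys_uminus]) (auto simp: F_def pderiv_minus)
    qed
    fix b x c y assume "(b, x) \<in> F ` graph_polys" "(c, y) \<in> F ` graph_polys"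
    then obtain g h g' h' where
      "(g, h) \<in> graph_polys" "F (g, h) = (b, x)" "(g', h') \<in> graph_polys" "F (g', h') = (c, y)"
      by force
    note gh = this
    show "(b + c, x + y) \<in> F ` graph_polys"
      using gh by (intro Fin[OF _ graph_polys_add[OF gh(1,3)]]) (auto simp: F_def pderiv_add algebra_simps)
    show "(b * c, b * y + x * c) \<in> F ` graph_polys"
      using gh by (intro Fin[OF _ graph_polys_mult[OF gh(1,3)]]) (auto simp: F_def pderiv_mult algebra_simps)
  next
    fix x assume "(0, x) \<in> F ` graph_polys"
    then obtain g h where "(g, h) \<in> graph_polys" "F (g, h) = (0, x)" by force
    then show "x = 0" using u[of g h] by (simp add: F_def)
  qed
  moreover have "G \<subseteq> F ` graph_polys"
  proof
    fix z assume "z \<in> G"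
    then show "z \<in> F ` graph_polys"
      using Fin[OF _ graph_polys_const[of "fst z" "snd z"]] by (simp add: F_def)
  qed
  moreover have "(a, u) \<in> F ` graph_polys"
    by (rule Fin[OF _ graph_polys_X]) (simp add: F_def pderiv_pCons)
  ultimately show ?thesis by blast
qed

end

text \<open>Zorn's lemma on the derivation graphs containing \<open>G\<close>; a maximal one is
  defined everywhere, since it could otherwise be extended by one more element.\<close>

lemma derivation_extending_graph:
  assumes G: "derivation_graph G"
  obtains D where "derivation D" "\<And>a x. (a, x) \<in> G \<Longrightarrow> D a = x"
proof -
  define A where "A = {H. derivation_graph H \<and> G \<subseteq> H}"
  have "\<exists>M\<in>A. \<forall>X\<in>A. M \<subseteq> X \<longrightarrow> X = M"
  proof (rule subset_Zorn_nonempty)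
    show "A \<noteq> {}" using G by (auto simp: A_def)
    fix C assume C: "C \<noteq> {}" "subset.chain A C"
    have cA: "H \<in> A" if "H \<in> C" for H using C(2) that by (auto simp: subset.chain_def)
    have dC: "derivation_graph H" if "H \<in> C" for H using cA[OF that] by (simp add: A_def)
    have two: "\<exists>H\<in>C. z \<in> H \<and> w \<in> H" if zw: "z \<in> \<Union>C" "w \<in> \<Union>C" for z w
    proof -
      obtain H K where HK: "H \<in> C" "z \<in> H" "K \<in> C" "w \<in> K" using zw by blast
      then have "H \<subseteq> K \<or> K \<subseteq> H" using C(2) by (auto simp: subset.chain_def)
      then show ?thesis using HK by blast
    qed
    have "derivation_graph (\<Union>C)"
      unfolding derivation_graph_def
    proof (intro conjI allI impI)
      show "(1, 0) \<in> \<Union>C" using C(1) dC graph_one by blast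
      show "(- a, - x) \<in> \<Union>C" if "(a, x) \<in> \<Union>C" for a x
        using that dC graph_uminus by blast
      show "x = 0" if "(0, x) \<in> \<Union>C" for x
        using that dC graph_zeroD by blast
      fix a x b y assume "(a, x) \<in> \<Union>C" "(b, y) \<in> \<Union>C"
      then obtain H where "H \<in> C" "(a, x) \<in> H" "(b, y) \<in> H" using two by blast
      then show "(a + b, x + y) \<in> \<Union>C" "(a * b, a * y + x * b) \<in> \<Union>C"
        using dC[of H] graph_add[of H] graph_mult[of H] by blast+
    qed
    then show "\<Union>C \<in> A" using C(1) cA by (auto simp: A_def)
  qed
  then obtain M where MA: "M \<in> A" and max: "\<And>X. X \<in> A \<Longrightarrow> M \<subseteq> X \<Longrightarrow> X = M" by blast
  then have M: "derivation_graph M" "G \<subseteq> M" by (auto simp: A_def)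
  have tot: "\<exists>u. (a, u) \<in> M" for a
  proof -
    obtain G' u where G': "derivation_graph G'" "M \<subseteq> G'" "(a, u) \<in> G'"
      using derivation_graph_extend[OF M(1), of a] by blast
    then have "G' = M" using M(2) by (intro max) (auto simp: A_def)
    with G'(3) show ?thesis by blast
  qed
  have uniq: "x = y" if "(a, x) \<in> M" "(a, y) \<in> M" for a x y
    using graph_zeroD[OF M(1), of "x - y"] graph_diff[OF M(1) that] by simp
  define D where "D a = (SOME x. (a, x) \<in> M)" for a
  have D: "(a, D a) \<in> M" for a unfolding D_def using tot someI_ex by metis
  show ?thesis
  proof
    show "derivation D" unfolding derivation_def
      using uniq[OF D graph_add[OF M(1) D D]] uniq[OF D graph_mult[OF M(1) D D]] by blast
    show "D a = x" if "(a, x) \<in> G" for a x using uniq[OF D] that M(2) by blast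
  qed
qed

section \<open>Rules of calculus for derivations of the reals\<close>

context
  fixes D assumes D: "derivation D"
begin

lemma derivation_add: "D (a + b) = D a + D b"
  and derivation_mult: "D (a * b) = a * D b + D a * b"
  using D by (auto simp: derivation_def)

lemma derivation_zero: "D 0 = 0"
  using derivation_add[of 0 0] by simp

lemma derivation_one: "D 1 = 0"
  using derivation_mult[of 1 1] by simp

lemma derivation_uminus: "D (- a) = - D a"
  using derivation_add[of a "- a"] derivation_zero by simp

lemma derivation_diff: "D (a - b) = D a - D b"
  using derivation_add[of a "- b"] derivation_uminus by simp

lemma derivation_sum: "D (sum f A) = (\<Sum>i\<in>A. D (f i))"
  by (induction A rule: infinite_finite_induct) (auto simp: derivation_zero derivation_add)

lemma derivation_of_nat: "D (of_nat n) = 0"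
  by (induction n) (auto simp: derivation_zero derivation_add derivation_one)

lemma derivation_of_int: "D (of_int k) = 0"
  by (cases k rule: int_cases2) (auto simp: derivation_of_nat derivation_uminus)

end

lemma derivation_linear_combination:
  assumes "\<And>i. i \<in> A \<Longrightarrow> derivation (D i)"
  shows "derivation (\<lambda>a. \<Sum>i\<in>A. c i * D i a)"
  using assms unfolding derivation_def
  by (auto simp: algebra_simps sum.distrib sum_distrib_left intro!: sum.cong)

section \<open>Rational polynomial functions and genericity\<close>

definition mpoly_monom :: "('i \<Rightarrow> real) \<Rightarrow> ('i \<Rightarrow>\<^sub>0 nat) \<Rightarrow> real" where
  "mpoly_monom x m = (\<Prod>i\<in>Poly_Mapping.keys m. x i ^ Poly_Mapping.lookup m i)"

lemma mpoly_monom_superset: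
  assumes "finite A" "Poly_Mapping.keys m \<subseteq> A"
  shows "mpoly_monom x m = (\<Prod>i\<in>A. x i ^ Poly_Mapping.lookup m i)"
  unfolding mpoly_monom_def
  by (rule prod.mono_neutral_left) (use assms in \<open>auto simp: in_keys_iff\<close>)

lemma mpoly_monom_add: "mpoly_monom x (m + n) = mpoly_monom x m * mpoly_monom x n"
  using mpoly_monom_superset[of "Poly_Mapping.keys m \<union> Poly_Mapping.keys n"] Poly_Mapping.keys_add[of m n]
  by (simp add: lookup_add power_add prod.distrib)

lemma eval_mpoly_superset:
  assumes "finite A" "Poly_Mapping.keys P \<subseteq> A"
  shows "eval_mpoly x P = (\<Sum>m\<in>A. of_rat (Poly_Mapping.lookup P m) * mpoly_monom x m)"
  unfolding eval_mpoly_def mpoly_monom_def[symmetric]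
  by (rule sum.mono_neutral_left) (use assms in \<open>auto simp: in_keys_iff\<close>)

lemma eval_mpoly_zero: "eval_mpoly x 0 = 0"
  by (simp add: eval_mpoly_def)

lemma eval_mpoly_add: "eval_mpoly x (P + Q) = eval_mpoly x P + eval_mpoly x Q"
  using eval_mpoly_superset[of "Poly_Mapping.keys P \<union> Poly_Mapping.keys Q"] Poly_Mapping.keys_add[of P Q]
  by (simp add: lookup_add of_rat_add distrib_right sum.distrib)

lemma eval_mpoly_sum: "eval_mpoly x (sum F A) = (\<Sum>i\<in>A. eval_mpoly x (F i))"
  by (induction A rule: infinite_finite_induct) (auto simp: eval_mpoly_zero eval_mpoly_add)

lemma eval_mpoly_single: "eval_mpoly x (Poly_Mapping.single m a) = of_rat a * mpoly_monom x m"
  using eval_mpoly_superset[of "{m}" "Poly_Mapping.single m a"] by simp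

lemma sum_single_lookup:
  "(\<Sum>m\<in>Poly_Mapping.keys P. Poly_Mapping.single m (Poly_Mapping.lookup P m)) = (P :: 'i rat_mpoly)"
proof (rule poly_mapping_eqI)
  fix k
  have "(\<Sum>m\<in>Poly_Mapping.keys P. Poly_Mapping.lookup P m when m = k) = Poly_Mapping.lookup P k"
    by (cases "k \<in> Poly_Mapping.keys P") (auto simp: when_def in_keys_iff)
  then show "Poly_Mapping.lookup (\<Sum>m\<in>Poly_Mapping.keys P. Poly_Mapping.single m (Poly_Mapping.lookup P m)) k =
      Poly_Mapping.lookup P k"
    by (simp add: lookup_sum lookup_single)
qed

lemma eval_mpoly_mult: "eval_mpoly x (P * Q) = eval_mpoly x P * eval_mpoly x Q"
proof -
  let ?s = "\<lambda>P m. Poly_Mapping.single m (Poly_Mapping.lookup P m)"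
  have "P * Q = (\<Sum>m\<in>Poly_Mapping.keys P. ?s P m) * (\<Sum>n\<in>Poly_Mapping.keys Q. ?s Q n)"
    by (simp add: sum_single_lookup)
  also have "\<dots> = (\<Sum>m\<in>Poly_Mapping.keys P. \<Sum>n\<in>Poly_Mapping.keys Q. ?s P m * ?s Q n)"
    by (rule sum_product)
  finally have "eval_mpoly x (P * Q) =
      (\<Sum>m\<in>Poly_Mapping.keys P. \<Sum>n\<in>Poly_Mapping.keys Q.
         (of_rat (Poly_Mapping.lookup P m) * mpoly_monom x m) * (of_rat (Poly_Mapping.lookup Q n) * mpoly_monom x n))"
    by (simp add: eval_mpoly_sum mult_single eval_mpoly_single of_rat_mult mpoly_monom_add mult_ac)
  also have "\<dots> = eval_mpoly x P * eval_mpoly x Q"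
    by (simp add: eval_mpoly_def mpoly_monom_def sum_product)
  finally show ?thesis .
qed

text \<open>Polynomial functions are generated inductively so that membership follows the shape of
  an expression; the link to formal polynomials is \<open>rat_polyfuns_eval_mpoly\<close>.\<close>

inductive_set rat_polyfuns :: "'i set \<Rightarrow> (('i \<Rightarrow> real) \<Rightarrow> real) set" for I where
  rat_polyfuns_const: "(\<lambda>_. of_rat r) \<in> rat_polyfuns I"
| rat_polyfuns_var: "i \<in> I \<Longrightarrow> (\<lambda>x. x i) \<in> rat_polyfuns I"
| rat_polyfuns_add: "g \<in> rat_polyfuns I \<Longrightarrow> h \<in> rat_polyfuns I \<Longrightarrow> (\<lambda>x. g x + h x) \<in> rat_polyfuns I"
| rat_polyfuns_mult: "g \<in> rat_polyfuns I \<Longrightarrow> h \<in> rat_polyfuns I \<Longrightarrow> (\<lambda>x. g x * h x) \<in> rat_polyfuns I"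

lemma rat_polyfuns_eval_mpoly:
  assumes "g \<in> rat_polyfuns I"
  shows "\<exists>P. mpoly_vars P \<subseteq> I \<and> (\<forall>x. eval_mpoly x P = g x)"
  using assms
proof induction
  case (rat_polyfuns_const r)
  show ?case
    by (intro exI[of _ "Poly_Mapping.single 0 r"]) (auto simp: eval_mpoly_single mpoly_monom_def mpoly_vars_def)
next
  case (rat_polyfuns_var i)
  then show ?case
    by (intro exI[of _ "Poly_Mapping.single (Poly_Mapping.single i 1) 1"])
       (auto simp: eval_mpoly_single mpoly_monom_def mpoly_vars_def)
next
  case (rat_polyfuns_add g h)
  then obtain P Q where "mpoly_vars P \<subseteq> I" "\<forall>x. eval_mpoly x P = g x"
    "mpoly_vars Q \<subseteq> I" "\<forall>x. eval_mpoly x Q = h x" by blast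
  moreover have "mpoly_vars (P + Q) \<subseteq> mpoly_vars P \<union> mpoly_vars Q"
    unfolding mpoly_vars_def using Poly_Mapping.keys_add[of P Q] by blast
  ultimately show ?case
    by (intro exI[of _ "P + Q"]) (auto simp: eval_mpoly_add)
next
  case (rat_polyfuns_mult g h)
  then obtain P Q where PQ: "mpoly_vars P \<subseteq> I" "\<forall>x. eval_mpoly x P = g x"
    "mpoly_vars Q \<subseteq> I" "\<forall>x. eval_mpoly x Q = h x" by blast
  have "mpoly_vars (P * Q) \<subseteq> mpoly_vars P \<union> mpoly_vars Q"
  proof
    fix i assume "i \<in> mpoly_vars (P * Q)"
    then obtain m where m: "m \<in> Poly_Mapping.keys (P * Q)" "i \<in> Poly_Mapping.keys m"
      by (auto simp: mpoly_vars_def)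
    then obtain a b where "m = a + b" "a \<in> Poly_Mapping.keys P" "b \<in> Poly_Mapping.keys Q"
      using keys_mult[of P Q] by blast
    then show "i \<in> mpoly_vars P \<union> mpoly_vars Q"
      using m(2) Poly_Mapping.keys_add[of a b] by (auto simp: mpoly_vars_def)
  qed
  then show ?case using PQ
    by (intro exI[of _ "P * Q"]) (auto simp: eval_mpoly_mult)
qed

lemma rat_polyfuns_uminus: "g \<in> rat_polyfuns I \<Longrightarrow> (\<lambda>x. - g x) \<in> rat_polyfuns I"
  using rat_polyfuns_mult[OF rat_polyfuns_const[of "-1"]] by simp

lemma rat_polyfuns_diff:
  "g \<in> rat_polyfuns I \<Longrightarrow> h \<in> rat_polyfuns I \<Longrightarrow> (\<lambda>x. g x - h x) \<in> rat_polyfuns I"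
  using rat_polyfuns_add[OF _ rat_polyfuns_uminus] by fastforce

lemma rat_polyfuns_of_int: "(\<lambda>_. of_int k) \<in> rat_polyfuns I"
  using rat_polyfuns_const[of "of_int k"] by simp

lemma rat_polyfuns_sum:
  "(\<And>i. i \<in> A \<Longrightarrow> g i \<in> rat_polyfuns I) \<Longrightarrow> (\<lambda>x. \<Sum>i\<in>A. g i x) \<in> rat_polyfuns I"
proof (induction A rule: infinite_finite_induct)
  case (insert i A)
  then show ?case using rat_polyfuns_add[of "g i" I] by simp
qed (use rat_polyfuns_of_int[of 0] in simp_all)

lemma rat_polyfuns_prod:
  "(\<And>i. i \<in> A \<Longrightarrow> g i \<in> rat_polyfuns I) \<Longrightarrow> (\<lambda>x. \<Prod>i\<in>A. g i x) \<in> rat_polyfuns I"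
proof (induction A rule: infinite_finite_induct)
  case (insert i A)
  then show ?case using rat_polyfuns_mult[of "g i" I] by simp
qed (use rat_polyfuns_of_int[of 1] in simp_all)

text \<open>A formal polynomial representing \<open>g\<close> vanishes at an independent point and
  is therefore 0. This carries identities from one generic framework to every other.\<close>

lemma algebraically_independent_vanishing:
  assumes "algebraically_independent I x" "g \<in> rat_polyfuns I" "g x = 0"
  shows "g y = 0"
  using rat_polyfuns_eval_mpoly[OF assms(2)] assms(1,3)
  by (metis algebraically_independent_def eval_mpoly_zero)

text \<open>Each value \<open>g x\<close> is assigned the derivative of \<open>g\<close> at
  \<open>x\<close> in direction \<open>y\<close>. Independence makes this single-valued, since
  \<open>g x = 0\<close> forces \<open>g\<close> to be identically 0; the result extends to all
  reals.\<close>

lemma derivation_with_values: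
  assumes x: "algebraically_independent I x"
  obtains D where "derivation D" "\<And>i. i \<in> I \<Longrightarrow> D (x i) = y i"
proof -
  define hasd where "hasd g d \<longleftrightarrow> ((\<lambda>t. g (\<lambda>i. x i + t * y i)) has_real_derivative d) (at 0)"
    for g :: "('a \<Rightarrow> real) \<Rightarrow> real" and d
  define G where "G = {(g x, d) | g d. g \<in> rat_polyfuns I \<and> hasd g d}"
  have GI: "(a, d) \<in> G" if "g \<in> rat_polyfuns I" "hasd g d" "g x = a" for g a d
    using that by (auto simp: G_def)
  have "derivation_graph G"
    unfolding derivation_graph_def
  proof (intro conjI allI impI)
    show "(1, 0) \<in> G"
      by (rule GI[OF rat_polyfuns_of_int[of 1]]) (auto simp: hasd_def)
    show "(- a, - d) \<in> G" if ad: "(a, d) \<in> G" for a d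
    proof -
      obtain g where "g \<in> rat_polyfuns I" "hasd g d" "g x = a" using ad by (auto simp: G_def)
      then show ?thesis
        by (intro GI[of "\<lambda>x. - g x"]) (auto simp: hasd_def rat_polyfuns_uminus DERIV_minus)
    qed
    fix a d b e assume "(a, d) \<in> G" "(b, e) \<in> G"
    then obtain g h where gh: "g \<in> rat_polyfuns I" "hasd g d" "g x = a"
      "h \<in> rat_polyfuns I" "hasd h e" "h x = b"
      by (auto simp: G_def)
    show "(a + b, d + e) \<in> G"
      using gh by (auto simp: hasd_def intro!: GI[OF rat_polyfuns_add[OF gh(1,4)]] DERIV_add)
    show "(a * b, a * e + d * b) \<in> G"
      using gh DERIV_mult[OF gh(2,5)[unfolded hasd_def]]
      by (auto simp: hasd_def algebra_simps intro!: GI[OF rat_polyfuns_mult[OF gh(1,4)]])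
  next
    fix d assume "(0, d) \<in> G"
    then obtain g where g: "g \<in> rat_polyfuns I" "hasd g d" "g x = 0" by (auto simp: G_def)
    have "g = (\<lambda>_. 0)" using algebraically_independent_vanishing[OF x g(1,3)] by blast
    then have "((\<lambda>t. 0) has_real_derivative d) (at 0)" using g(2) by (simp add: hasd_def)
    then show "d = 0" using DERIV_const DERIV_unique by blast
  qed
  then obtain D where D: "derivation D" "\<And>a d. (a, d) \<in> G \<Longrightarrow> D a = d"
    using derivation_extending_graph by blast
  have "(x i, y i) \<in> G" if "i \<in> I" for i
    by (rule GI[OF rat_polyfuns_var[OF that]]) (auto simp: hasd_def intro!: derivative_eq_intros)
  with D show ?thesis by (intro that) auto
qed

section \<open>Edges, stresses and stress kernels\<close>

definition ediff :: "('v, 'd::finite) gain_triple \<Rightarrow> ('v \<Rightarrow> real) \<Rightarrow> real" where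
  "ediff t y = y (fst (snd t)) - y (fst t)"

text \<open>Coordinate \<open>i\<close> of the vector inside the norm of \<open>edge_length\<close>,
  split into a part linear in the placement and a part depending only on the lattice.\<close>

definition evec :: "('v \<Rightarrow> real ^ 'd) \<Rightarrow> real ^ 'd ^ 'd \<Rightarrow> ('v, 'd::finite) gain_triple \<Rightarrow> 'd \<Rightarrow> real" where
  "evec p L t i = ediff t (\<lambda>v. p v $ i) + (\<Sum>j\<in>UNIV. L $ i $ j * of_int (snd (snd t) $ j))"

lemma ediff_add: "ediff t (\<lambda>v. y v + z v) = ediff t y + ediff t z"
  and ediff_diff: "ediff t (\<lambda>v. y v - z v) = ediff t y - ediff t z"
  and ediff_scale: "ediff t (\<lambda>v. r * y v) = r * ediff t y"
  and ediff_const: "ediff t (\<lambda>_. r) = 0"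
  by (simp_all add: ediff_def algebra_simps)

lemma ediff_sum: "ediff t (\<lambda>v. \<Sum>i\<in>A. y i v) = (\<Sum>i\<in>A. ediff t (y i))"
  by (simp add: ediff_def sum_subtractf)

lemma edge_length_evec: "(edge_length p L t)\<^sup>2 = (\<Sum>i\<in>UNIV. (evec p L t i)\<^sup>2)"
proof (cases t)
  case (fields u v \<gamma>)
  have "(p v + L *v gain_vec \<gamma> - p u) $ i = evec p L t i" for i
    by (simp add: evec_def ediff_def fields matrix_vector_mult_def gain_vec_def)
  then show ?thesis
    by (simp add: edge_length_def fields norm_vec_def L2_set_def sum_nonneg)
qed

lemma edge_length_eq_iff:
  "edge_length p L t = edge_length q L' t \<longleftrightarrow> (\<Sum>i\<in>UNIV. (evec p L t i)\<^sup>2) = (\<Sum>i\<in>UNIV. (evec q L' t i)\<^sup>2)"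
proof -
  have "0 \<le> edge_length p L t" "0 \<le> edge_length q L' t"
    by (auto simp: edge_length_def split: prod.split)
  then show ?thesis
    unfolding edge_length_evec[symmetric] by (simp add: power2_eq_iff_nonneg)
qed

lemma derivation_ediff: "derivation D \<Longrightarrow> D (ediff t y) = ediff t (\<lambda>v. D (y v))"
  by (simp add: ediff_def derivation_diff)

lemma derivation_evec:
  assumes "derivation D" "\<And>i j. D (L $ i $ j) = 0"
  shows "D (evec p L t i) = ediff t (\<lambda>v. D (p v $ i))"
  using assms
  by (simp add: evec_def derivation_add derivation_sum derivation_mult derivation_of_int derivation_ediff)

text \<open>\<open>T\<close> will be the union of the edge classes, so it contains each edge in both
  orientations and a stress may weigh them separately. The root \<open>v0\<close> serves to
  normalize translations.\<close>

locale gain_edges =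
  fixes V :: "'v set" and T :: "('v, 'd::finite) gain_triple set" and v0 :: 'v
  assumes finV: "finite V" and finT: "finite T" and v0: "v0 \<in> V"
    and ends: "t \<in> T \<Longrightarrow> fst t \<in> V \<and> fst (snd t) \<in> V"
begin

text \<open>Kirchhoff's law in weak form: \<open>c\<close> is a circulation, tested against all
  functions on the vertices; \<open>balanced_iff\<close> recovers the condition at each
  vertex.\<close>

definition balanced :: "(('v, 'd) gain_triple \<Rightarrow> real) \<Rightarrow> bool" where
  "balanced c \<longleftrightarrow> (\<forall>y. (\<Sum>t\<in>T. c t * ediff t y) = 0)"

text \<open>Equilibrium stress for a fixed lattice: only the placement is varied, so no condition
  arises from the entries of \<open>L\<close>.\<close>

definition stress :: "('v \<Rightarrow> real ^ 'd) \<Rightarrow> real ^ 'd ^ 'd \<Rightarrow> (('v, 'd) gain_triple \<Rightarrow> real) \<Rightarrow> bool" where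
  "stress p L \<omega> \<longleftrightarrow> (\<forall>i. balanced (\<lambda>t. \<omega> t * evec p L t i))"

definition stress_kernel :: "(('v, 'd) gain_triple \<Rightarrow> real) \<Rightarrow> ('v \<Rightarrow> real) \<Rightarrow> bool" where
  "stress_kernel \<omega> z \<longleftrightarrow> balanced (\<lambda>t. \<omega> t * ediff t z)"

abbreviation const_on_V :: "('v \<Rightarrow> real) \<Rightarrow> bool" where
  "const_on_V z \<equiv> \<forall>v\<in>V. z v = z v0"

lemma ediff_cong: "t \<in> T \<Longrightarrow> (\<And>v. v \<in> V \<Longrightarrow> y v = z v) \<Longrightarrow> ediff t y = ediff t z"
  using ends by (simp add: ediff_def)

lemma ediff_const_on_V: "t \<in> T \<Longrightarrow> const_on_V z \<Longrightarrow> ediff t z = 0"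
  using ends[of t] by (simp add: ediff_def)

lemma ediff_indicators: "t \<in> T \<Longrightarrow> (\<Sum>v\<in>V. y v * ediff t (indicator {v})) = ediff t y"
  using finV ends[of t]
  by (simp add: ediff_def right_diff_distrib sum_subtractf indicator_def if_distrib[of "\<lambda>x. _ * x"] cong: if_cong)

text \<open>Expands \<open>y\<close> in vertex indicators; it serves to pass between conditions at
  vertices and pairings along edges.\<close>

lemma sum_indicators:
  "(\<Sum>v\<in>V. y v * (\<Sum>t\<in>T. c t * ediff t (indicator {v}))) = (\<Sum>t\<in>T. c t * ediff t y)"
proof -
  have "(\<Sum>v\<in>V. y v * (\<Sum>t\<in>T. c t * ediff t (indicator {v}))) =
      (\<Sum>t\<in>T. \<Sum>v\<in>V. c t * (y v * ediff t (indicator {v})))"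
    unfolding sum_distrib_left by (subst sum.swap) (simp add: mult_ac)
  also have "\<dots> = (\<Sum>t\<in>T. c t * ediff t y)"
    by (intro sum.cong refl) (simp add: sum_distrib_left[symmetric] ediff_indicators)
  finally show ?thesis .
qed

lemma balancedD: "balanced c \<Longrightarrow> (\<Sum>t\<in>T. c t * ediff t y) = 0"
  by (simp add: balanced_def)

lemma balanced_iff: "balanced c \<longleftrightarrow> (\<forall>v\<in>V. (\<Sum>t\<in>T. c t * ediff t (indicator {v})) = 0)"
proof
  assume *: "\<forall>v\<in>V. (\<Sum>t\<in>T. c t * ediff t (indicator {v})) = 0"
  show "balanced c"
    unfolding balanced_def
  proof
    fix y
    have "(\<Sum>t\<in>T. c t * ediff t y) = (\<Sum>v\<in>V. y v * (\<Sum>t\<in>T. c t * ediff t (indicator {v})))"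
      by (rule sum_indicators[symmetric])
    then show "(\<Sum>t\<in>T. c t * ediff t y) = 0" using * by simp
  qed
qed (simp add: balanced_def)

text \<open>The conditions at all vertices add up to 0, because constants have zero difference along
  every edge; so the one at the root follows from the others.\<close>

lemma balanced_iff_root:
  "balanced c \<longleftrightarrow> (\<forall>v\<in>V - {v0}. (\<Sum>t\<in>T. c t * ediff t (indicator {v})) = 0)"
proof
  assume *: "\<forall>v\<in>V - {v0}. (\<Sum>t\<in>T. c t * ediff t (indicator {v})) = 0"
  have "(\<Sum>v\<in>V. 1 * (\<Sum>t\<in>T. c t * ediff t (indicator {v}))) = 0"
    unfolding sum_indicators by (simp add: ediff_const)
  then have "(\<Sum>t\<in>T. c t * ediff t (indicator {v0})) = 0"
    using * finV v0 by (simp add: sum.remove[of V v0])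
  with * show "balanced c" unfolding balanced_iff by blast
qed (simp add: balanced_def)

lemma balanced_cong: "(\<And>t. t \<in> T \<Longrightarrow> c t = c' t) \<Longrightarrow> balanced c = balanced c'"
  by (simp add: balanced_def)

lemma balanced_add: "balanced c \<Longrightarrow> balanced c' \<Longrightarrow> balanced (\<lambda>t. c t + c' t)"
  and balanced_diff: "balanced c \<Longrightarrow> balanced c' \<Longrightarrow> balanced (\<lambda>t. c t - c' t)"
  and balanced_scale: "balanced c \<Longrightarrow> balanced (\<lambda>t. r * c t)"
  by (simp_all add: balanced_def algebra_simps sum.distrib sum_subtractf sum_distrib_left[symmetric])

text \<open>Balance is a linear system with integer coefficients, which derivations kill; so a
  derivation may be applied to a solution entry by entry.\<close>

lemma balanced_derivation:
  assumes D: "derivation D" and c: "balanced c"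
  shows "balanced (\<lambda>t. D (c t))"
  unfolding balanced_iff
proof
  fix v
  have int: "D (ediff t (indicator {v})) = 0" for t :: "('v, 'd) gain_triple"
    using D by (simp add: derivation_ediff[OF D] ediff_def indicator_def derivation_zero derivation_one derivation_uminus)
  have "D (\<Sum>t\<in>T. c t * ediff t (indicator {v})) = (\<Sum>t\<in>T. D (c t) * ediff t (indicator {v}))"
    by (simp add: derivation_sum[OF D] derivation_mult[OF D] int)
  then show "(\<Sum>t\<in>T. D (c t) * ediff t (indicator {v})) = 0"
    using balancedD[OF c] by (simp add: derivation_zero[OF D])
qed

lemma stress_kernelD: "stress_kernel \<omega> z \<Longrightarrow> (\<Sum>t\<in>T. \<omega> t * ediff t z * ediff t y) = 0"
  unfolding stress_kernel_def by (drule balancedD)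

lemma stress_kernel_combination:
  "(\<And>i. i \<in> A \<Longrightarrow> stress_kernel \<omega> (z i)) \<Longrightarrow> stress_kernel \<omega> (\<lambda>v. \<Sum>i\<in>A. c i * z i v)"
proof (induction A rule: infinite_finite_induct)
  case (insert i A)
  then have "balanced (\<lambda>t. c i * (\<omega> t * ediff t (z i)) + \<omega> t * ediff t (\<lambda>v. \<Sum>i\<in>A. c i * z i v))"
    by (intro balanced_add balanced_scale) (auto simp: stress_kernel_def)
  then show ?case using insert.hyps
    by (simp add: stress_kernel_def ediff_add ediff_scale algebra_simps)
qed (simp_all add: stress_kernel_def ediff_const balanced_def)

lemma stress_kernel_diff:
  "stress_kernel \<omega> y \<Longrightarrow> stress_kernel \<omega> z \<Longrightarrow> stress_kernel \<omega> (\<lambda>v. y v - z v)"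
  unfolding stress_kernel_def ediff_diff right_diff_distrib by (rule balanced_diff)

lemma stress_kernel_scale: "stress_kernel \<omega> z \<Longrightarrow> stress_kernel \<omega> (\<lambda>v. r * z v)"
  unfolding stress_kernel_def ediff_scale mult.left_commute[of _ r] by (rule balanced_scale)

end

section \<open>Stresses with trivial kernel\<close>

context gain_edges
begin

text \<open>The algebraic substitute for genericity: with the entries of \<open>L\<close> as
  constants, the placement can be differentiated in any direction.\<close>

definition free_placement :: "('v \<Rightarrow> real ^ 'd) \<Rightarrow> real ^ 'd ^ 'd \<Rightarrow> bool" where
  "free_placement p L \<longleftrightarrow>
     (\<forall>\<psi>. \<exists>D. derivation D \<and> (\<forall>i j. D (L $ i $ j) = 0) \<and> (\<forall>v\<in>V. \<forall>i. D (p v $ i) = \<psi> i v))"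

lemma free_placement_derivation:
  assumes "free_placement p L"
  shows "\<exists>D. derivation D \<and> (\<forall>t\<in>T. \<forall>i. D (evec p L t i) = ediff t (\<psi> i))"
proof -
  obtain D where D: "derivation D" "\<And>i j. D (L $ i $ j) = 0" "\<And>v i. v \<in> V \<Longrightarrow> D (p v $ i) = \<psi> i v"
    using assms unfolding free_placement_def by blast
  have "D (evec p L t i) = ediff t (\<psi> i)" if "t \<in> T" for t i
    unfolding derivation_evec[OF D(1,2)] by (rule ediff_cong[OF that D(3)])
  with D(1) show ?thesis by blast
qed

lemma stressD: "stress p L \<omega> \<Longrightarrow> (\<Sum>t\<in>T. \<omega> t * evec p L t i * ediff t y) = 0"
  unfolding stress_def by (blast dest: balancedD)

lemma stress_sumD:
  assumes "stress p L \<omega>"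
  shows "(\<Sum>t\<in>T. \<omega> t * (\<Sum>i\<in>UNIV. evec p L t i * ediff t (y i))) = 0"
proof -
  have "(\<Sum>t\<in>T. \<omega> t * (\<Sum>i\<in>UNIV. evec p L t i * ediff t (y i))) =
      (\<Sum>i\<in>UNIV. \<Sum>t\<in>T. \<omega> t * evec p L t i * ediff t (y i))"
    unfolding sum_distrib_left by (subst sum.swap) (simp add: mult.assoc)
  then show ?thesis by (simp add: stressD[OF assms])
qed

text \<open>The flex equation is differentiated along a derivation that moves only coordinate
  \<open>k\<close> of a vertex \<open>a\<close>. Weighted by \<open>\<omega>\<close>, the terms with
  the derivative of \<open>z\<close> cancel by the stress equation, leaving the Laplacian of
  \<open>z k\<close> at \<open>a\<close>.\<close>

lemma infinitesimal_flex_in_stress_kernel: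
  assumes free: "free_placement p L" and st: "stress p L \<omega>"
    and flex: "\<And>t. t \<in> T \<Longrightarrow> (\<Sum>i\<in>UNIV. evec p L t i * ediff t (z i)) = 0"
  shows "stress_kernel \<omega> (z k)"
  unfolding stress_kernel_def balanced_iff
proof
  fix a assume "a \<in> V"
  define \<psi> where "\<psi> i = (if i = k then indicator {a} else (\<lambda>_. 0 :: real))" for i
  obtain D where D: "derivation D" "\<And>t i. t \<in> T \<Longrightarrow> D (evec p L t i) = ediff t (\<psi> i)"
    using free_placement_derivation[OF free, of \<psi>] by blast
  have *: "ediff t (z k) * ediff t (indicator {a}) = - (\<Sum>i\<in>UNIV. evec p L t i * ediff t (\<lambda>v. D (z i v)))"
    if t: "t \<in> T" for t
  proof -
    have "0 = D (\<Sum>i\<in>UNIV. evec p L t i * ediff t (z i))"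
      using flex[OF t] derivation_zero[OF D(1)] by simp
    also have "\<dots> = (\<Sum>i\<in>UNIV. evec p L t i * ediff t (\<lambda>v. D (z i v)) + ediff t (\<psi> i) * ediff t (z i))"
      by (simp add: derivation_sum[OF D(1)] derivation_mult[OF D(1)] D(2)[OF t] derivation_ediff[OF D(1)])
    also have "\<dots> = (\<Sum>i\<in>UNIV. evec p L t i * ediff t (\<lambda>v. D (z i v))) + ediff t (indicator {a}) * ediff t (z k)"
      by (simp add: sum.distrib \<psi>_def if_distrib[of "\<lambda>y. ediff t y * _"] ediff_const cong: if_cong)
    finally show ?thesis by (simp add: mult.commute)
  qed
  have "(\<Sum>t\<in>T. \<omega> t * ediff t (z k) * ediff t (indicator {a})) =
      - (\<Sum>t\<in>T. \<omega> t * (\<Sum>i\<in>UNIV. evec p L t i * ediff t (\<lambda>v. D (z i v))))"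
    by (simp add: mult.assoc * sum_negf)
  then show "(\<Sum>t\<in>T. \<omega> t * ediff t (z k) * ediff t (indicator {a})) = 0"
    by (simp add: stress_sumD[OF st])
qed

lemma derivation_edge_lengths:
  assumes D: "derivation D" "\<And>i j. D (L $ i $ j) = 0"
    and eq: "edge_length p L t = edge_length q L t"
  shows "(\<Sum>i\<in>UNIV. evec p L t i * ediff t (\<lambda>v. D (p v $ i))) =
    (\<Sum>i\<in>UNIV. evec q L t i * ediff t (\<lambda>v. D (q v $ i)))"
proof -
  have *: "D (\<Sum>i\<in>UNIV. (evec r L t i)\<^sup>2) = 2 * (\<Sum>i\<in>UNIV. evec r L t i * ediff t (\<lambda>v. D (r v $ i)))" for r
    by (simp add: power2_eq_square derivation_sum[OF D(1)] derivation_mult[OF D(1)] derivation_evec[OF D]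
        sum_distrib_left mult_ac)
  have "(\<Sum>i\<in>UNIV. (evec p L t i)\<^sup>2) = (\<Sum>i\<in>UNIV. (evec q L t i)\<^sup>2)"
    using eq unfolding edge_length_eq_iff .
  from arg_cong[OF this, of D] show ?thesis unfolding * by simp
qed

text \<open>
  Differentiating \<open>f(q) = f(p)\<close> along derivations that fix the lattice shows that the tangent space of
  the image of the length map at \<open>f(p)\<close> is spanned by the differential at \<open>q\<close> as well; hence a stress
  of \<open>p\<close> is a stress of \<open>q\<close>.
\<close>

lemma stress_of_equivalent_placement:
  assumes free: "free_placement p L" and st: "stress p L \<omega>"
    and ker: "\<And>z. stress_kernel \<omega> z \<Longrightarrow> const_on_V z"
    and eq: "\<And>t. t \<in> T \<Longrightarrow> edge_length p L t = edge_length q L t"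
  shows "stress q L \<omega>"
proof (rule ccontr)
  assume nst: "\<not> stress q L \<omega>"
  \<comment> \<open>Omitting the root factors out translations and makes the matrix \<open>N\<close>
    below square.\<close>
  define J where "J = (V - {v0}) \<times> (UNIV :: 'd set)"
  have finJ: "finite J" by (simp add: J_def finV)
  \<comment> \<open>The resultant force of \<open>\<omega>\<close> at \<open>q\<close>; if it
    vanished on \<open>J\<close>, then \<open>\<omega>\<close> would be a stress of
    \<open>q\<close>.\<close>
  define \<rho> where "\<rho> = (\<lambda>(w, k). \<Sum>t\<in>T. \<omega> t * evec q L t k * ediff t (indicator {w}))"
  obtain k where "\<not> balanced (\<lambda>t. \<omega> t * evec q L t k)" using nst by (auto simp: stress_def)
  then obtain w where "w \<in> V - {v0}" "\<rho> (w, k) \<noteq> 0"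
    unfolding balanced_iff_root by (auto simp: \<rho>_def)
  then have \<rho>: "\<exists>j\<in>J. \<rho> j \<noteq> 0" by (auto simp: J_def)
  have "\<exists>D. derivation D \<and> (\<forall>i l. D (L $ i $ l) = 0) \<and>
      (\<forall>v\<in>V. \<forall>i. D (p v $ i) = (if (v, i) = j then 1 else 0))" for j
    using free[unfolded free_placement_def, rule_format, of "\<lambda>i v. if (v, i) = j then 1 else 0"] .
  then obtain D where D: "\<And>j. derivation (D j)" "\<And>j i l. D j (L $ i $ l) = 0"
    "\<And>j v i. v \<in> V \<Longrightarrow> D j (p v $ i) = (if (v, i) = j then 1 else 0)"
    by metis
  \<comment> \<open>Row \<open>j\<close> is the motion of \<open>q\<close> relative to the root when
    coordinate \<open>j\<close> of \<open>p\<close> moves at unit speed. Equal lengths have equal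
    derivatives, so the stress equation of \<open>p\<close> puts \<open>\<rho>\<close> in the kernel
    of \<open>N\<close>.\<close>
  define N where "N = (\<lambda>j (w, k). D j (q w $ k) - D j (q v0 $ k))"
  have "(\<Sum>m\<in>J. N j m * \<rho> m) = 0" for j
  proof -
    have "(\<Sum>w\<in>V - {v0}. N j (w, k) * \<rho> (w, k)) = (\<Sum>t\<in>T. \<omega> t * evec q L t k * ediff t (\<lambda>w. D j (q w $ k)))" for k
    proof -
      have "(\<Sum>w\<in>V - {v0}. N j (w, k) * \<rho> (w, k)) = (\<Sum>w\<in>V. N j (w, k) * \<rho> (w, k))"
        using finV v0 by (simp add: sum.remove[of V v0] N_def)
      also have "\<dots> = (\<Sum>t\<in>T. \<omega> t * evec q L t k * ediff t (\<lambda>w. N j (w, k)))"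
        unfolding \<rho>_def prod.case by (rule sum_indicators)
      finally show ?thesis by (simp add: N_def ediff_diff ediff_const)
    qed
    moreover have "(\<Sum>m\<in>J. N j m * \<rho> m) = (\<Sum>k\<in>UNIV. \<Sum>w\<in>V - {v0}. N j (w, k) * \<rho> (w, k))"
      unfolding J_def sum.cartesian_product' by (rule sum.swap)
    ultimately have "(\<Sum>m\<in>J. N j m * \<rho> m) =
        (\<Sum>k\<in>UNIV. \<Sum>t\<in>T. \<omega> t * evec q L t k * ediff t (\<lambda>w. D j (q w $ k)))"
      by simp
    also have "\<dots> = (\<Sum>t\<in>T. \<omega> t * (\<Sum>k\<in>UNIV. evec q L t k * ediff t (\<lambda>w. D j (q w $ k))))"
      unfolding sum_distrib_left by (subst sum.swap) (simp add: mult.assoc)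
    also have "\<dots> = (\<Sum>t\<in>T. \<omega> t * (\<Sum>k\<in>UNIV. evec p L t k * ediff t (\<lambda>w. D j (p w $ k))))"
      using derivation_edge_lengths[OF D(1,2) eq] by simp
    finally show ?thesis by (simp add: stress_sumD[OF st])
  qed
  note kernel = left_kernel_if_right_kernel[of J \<rho> N, OF finJ \<rho> this]
  obtain c where c: "\<exists>j\<in>J. c j \<noteq> 0" "\<And>m. m \<in> J \<Longrightarrow> (\<Sum>j\<in>J. c j * N j m) = 0"
    using kernel by blast
  \<comment> \<open>A left kernel vector of \<open>N\<close> yields a derivation that moves
    \<open>q\<close> by a translation and \<open>p\<close> by \<open>c\<close>. The motion of
    \<open>p\<close> is then an infinitesimal flex, hence constant by \<open>ker\<close>; it is 0 at
    the root, so \<open>c\<close> vanishes.\<close>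
  define \<Delta> where "\<Delta> a = (\<Sum>j\<in>J. c j * D j a)" for a
  have \<Delta>: "derivation \<Delta>" "\<And>i l. \<Delta> (L $ i $ l) = 0"
    unfolding \<Delta>_def using D(1,2) by (auto intro: derivation_linear_combination)
  have \<Delta>q: "\<Delta> (q w $ k) = \<Delta> (q v0 $ k)" if "w \<in> V" for w k
  proof (cases "w = v0")
    case False
    then have "(\<Sum>j\<in>J. c j * N j (w, k)) = 0" using c(2) that by (auto simp: J_def)
    then show ?thesis by (simp add: N_def \<Delta>_def right_diff_distrib sum_subtractf)
  qed simp
  have \<Delta>p: "\<Delta> (p w $ k) = (if (w, k) \<in> J then c (w, k) else 0)" if "w \<in> V" for w k
    using finJ that by (simp add: \<Delta>_def D(3) if_distrib[of "\<lambda>x. _ * x"] cong: if_cong)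
  have "stress_kernel \<omega> (\<lambda>v. \<Delta> (p v $ k))" for k
  proof (rule infinitesimal_flex_in_stress_kernel[OF free st])
    fix t assume t: "t \<in> T"
    have "ediff t (\<lambda>v. \<Delta> (q v $ i)) = 0" for i
      using \<Delta>q by (intro ediff_const_on_V t) auto
    then show "(\<Sum>i\<in>UNIV. evec p L t i * ediff t (\<lambda>v. \<Delta> (p v $ i))) = 0"
      using derivation_edge_lengths[OF \<Delta> eq[OF t]] by simp
  qed
  from ker[OF this] have "\<Delta> (p w $ k) = \<Delta> (p v0 $ k)" if "w \<in> V" for w k using that by blast
  moreover have "\<Delta> (p v0 $ k) = 0" for k using \<Delta>p[OF v0] by (simp add: J_def)
  ultimately have "c j = 0" if "j \<in> J" for j
    using that \<Delta>p[of "fst j" "snd j"] by (auto simp: J_def)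
  with c(1) show False by blast
qed

text \<open>Both placements satisfy the stress equation with the same \<open>\<omega>\<close>; in
  the difference the lattice terms cancel and the Laplacian equation for \<open>q - p\<close>
  remains.\<close>

lemma unique_placement_if_stress_kernel_trivial:
  assumes "free_placement p L" and st: "stress p L \<omega>"
    and ker: "\<And>z. stress_kernel \<omega> z \<Longrightarrow> const_on_V z"
    and "\<And>t. t \<in> T \<Longrightarrow> edge_length p L t = edge_length q L t"
  shows "const_on_V (\<lambda>v. q v $ i - p v $ i)"
proof (rule ker)
  have "balanced (\<lambda>t. \<omega> t * evec q L t i - \<omega> t * evec p L t i)"
    using stress_of_equivalent_placement[OF assms] st
    unfolding stress_def by (intro balanced_diff) auto
  then show "stress_kernel \<omega> (\<lambda>v. q v $ i - p v $ i)"
    by (simp add: stress_kernel_def evec_def ediff_diff algebra_simps)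
qed

text \<open>
  Take \<open>\<omega>\<close> whose kernel needs the fewest coordinates \<open>J\<close> to be parametrized. If \<open>\<sigma>\<close> did not vanish on some
  \<open>z\<close> in the kernel, then the kernel of \<open>\<omega> + r \<sigma>\<close> for small \<open>r\<close> would satisfy the additional equation
  \<open>\<sigma>(z, _) = 0\<close> and need one coordinate less.
\<close>

lemma generic_stress_exists:
  assumes S: "S \<noteq> {}" "\<And>\<omega> \<sigma> m. \<omega> \<in> S \<Longrightarrow> \<sigma> \<in> S \<Longrightarrow> (\<lambda>t. \<omega> t + 1 / real (Suc m) * \<sigma> t) \<in> S"
  shows "\<exists>\<omega>\<in>S. \<forall>\<sigma>\<in>S. \<forall>z. stress_kernel \<omega> z \<longrightarrow> (\<Sum>t\<in>T. \<sigma> t * (ediff t z)\<^sup>2) = 0"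
proof -
  define P where "P \<omega> J \<longleftrightarrow> J \<subseteq> V \<and> (\<forall>z. stress_kernel \<omega> z \<longrightarrow> (\<forall>j\<in>J. z j = 0) \<longrightarrow> (\<forall>v\<in>V. z v = 0))"
    for \<omega> J
  have ex: "\<exists>n. \<exists>\<omega> J. \<omega> \<in> S \<and> P \<omega> J \<and> card J = n"
    using S(1) by (auto simp: P_def)
  define n where "n = (LEAST n. \<exists>\<omega> J. \<omega> \<in> S \<and> P \<omega> J \<and> card J = n)"
  obtain \<omega> J where \<omega>: "\<omega> \<in> S" "P \<omega> J" "card J = n"
    using LeastI_ex[OF ex] unfolding n_def by blast
  have least: "n \<le> card J'" if "\<sigma> \<in> S" "P \<sigma> J'" for \<sigma> J'
    unfolding n_def by (rule Least_le) (use that in blast)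
  have J: "J \<subseteq> V" "finite J" using \<omega>(2) finV finite_subset by (auto simp: P_def)
  have inj: "\<forall>v\<in>V. z v = 0" if "stress_kernel \<omega> z" "\<And>j. j \<in> J \<Longrightarrow> z j = 0" for z
    using \<omega>(2) that by (auto simp: P_def)
  have smaller: "\<not> P \<sigma> (J - {j})" if "\<sigma> \<in> S" "j \<in> J" for \<sigma> j
    using least[OF that(1), of "J - {j}"] \<omega>(3) card_Diff1_less[OF J(2) that(2)] by auto
  have "\<exists>w\<in>{z. stress_kernel \<omega> z}. (\<forall>i\<in>J - {j}. w i = 0) \<and> \<not> (\<forall>v\<in>V. w v = 0)" if "j \<in> J" for j
    using smaller[OF \<omega>(1) that] J(1) by (auto simp: P_def)
  note min = this
  have "\<exists>b. \<forall>j\<in>J. b j \<in> {z. stress_kernel \<omega> z} \<and> (\<forall>i\<in>J. b j i = (if i = j then 1 else 0))"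
  proof (rule coordinate_dual_basis[of _ J V])
    show "(\<lambda>v. r * w v) \<in> {z. stress_kernel \<omega> z}" if "w \<in> {z. stress_kernel \<omega> z}" for w r
      using that stress_kernel_scale by blast
    show "\<forall>v\<in>V. w v = 0" if "w \<in> {z. stress_kernel \<omega> z}" "\<And>j. j \<in> J \<Longrightarrow> w j = 0" for w
      using inj that by blast
  qed (rule min)
  then obtain b where b: "\<And>j. j \<in> J \<Longrightarrow> stress_kernel \<omega> (b j)"
    "\<And>i j. i \<in> J \<Longrightarrow> j \<in> J \<Longrightarrow> b j i = (if i = j then 1 else 0)"
    by blast
  have expand: "z v = (\<Sum>j\<in>J. z j * b j v)" if z: "stress_kernel \<omega> z" and v: "v \<in> V" for z v
  proof -
    have "stress_kernel \<omega> (\<lambda>v. z v - (\<Sum>j\<in>J. z j * b j v))"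
      by (intro stress_kernel_diff z stress_kernel_combination b(1))
    from inj[OF this] v show ?thesis
      using J(2) b(2) by (simp add: if_distrib[of "\<lambda>x. _ * x"] cong: if_cong)
  qed
  have "(\<Sum>t\<in>T. \<sigma> t * (ediff t z)\<^sup>2) = 0" if \<sigma>: "\<sigma> \<in> S" and z: "stress_kernel \<omega> z" for \<sigma> z
  proof (rule ccontr)
    define B where "B y = (\<Sum>t\<in>T. \<sigma> t * ediff t z * ediff t y)" for y
    assume "(\<Sum>t\<in>T. \<sigma> t * (ediff t z)\<^sup>2) \<noteq> 0"
    then have "B z \<noteq> 0" by (simp add: B_def power2_eq_square mult.assoc)
    have Bcong: "B y = B y'" if "\<And>v. v \<in> V \<Longrightarrow> y v = y' v" for y y'
      unfolding B_def using ediff_cong[OF _ that] by (intro sum.cong) auto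
    have "B z = B (\<lambda>v. \<Sum>j\<in>J. z j * b j v)" by (intro Bcong expand z)
    also have "\<dots> = (\<Sum>j\<in>J. z j * B (b j))"
      unfolding B_def ediff_sum ediff_scale sum_distrib_left by (subst sum.swap) (simp add: mult_ac)
    finally have Bz: "B z = (\<Sum>j\<in>J. z j * B (b j))" .
    have "\<exists>k\<in>J. B (b k) \<noteq> 0"
    proof (rule ccontr)
      assume "\<not> ?thesis"
      then have "(\<Sum>j\<in>J. z j * B (b j)) = 0" by (intro sum.neutral) auto
      with Bz \<open>B z \<noteq> 0\<close> show False by simp
    qed
    then obtain k where k: "k \<in> J" "B (b k) \<noteq> 0" by blast
    define col where "col \<eta> y v = (\<Sum>t\<in>T. \<eta> t * ediff t y * ediff t (indicator {v}))" for \<eta> y v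
    define I where "I = V <+> ((J - {k}) <+> {()})"
    \<comment> \<open>The rows are the Laplacian of \<open>\<omega>\<close>, the coordinates in
      \<open>J - {k}\<close> and \<open>B\<close>. The first two kinds leave only multiples of
      \<open>b k\<close>, which \<open>B\<close> detects, so \<open>M0\<close> is injective;
      \<open>M1\<close> perturbs the Laplacian rows by that of \<open>\<sigma>\<close>.\<close>
    define M0 :: "'v + ('v + unit) \<Rightarrow> 'v \<Rightarrow> real" where
      "M0 = case_sum (\<lambda>a. col \<omega> (indicator {a})) (case_sum (\<lambda>j v. if v = j then 1 else 0) (\<lambda>_. col \<sigma> z))"
    define M1 :: "'v + ('v + unit) \<Rightarrow> 'v \<Rightarrow> real" where
      "M1 = case_sum (\<lambda>a. col \<sigma> (indicator {a})) (\<lambda>_ _. 0)"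
    have sum_col: "(\<Sum>v\<in>V. y v * col \<eta> x v) = (\<Sum>t\<in>T. \<eta> t * ediff t x * ediff t y)" for y x \<eta>
      unfolding col_def by (rule sum_indicators)
    have kerI: "stress_kernel \<eta> y"
      if "\<And>a. a \<in> V \<Longrightarrow> (\<Sum>v\<in>V. y v * col \<eta> (indicator {a}) v) = 0" for y \<eta>
      using that unfolding stress_kernel_def balanced_iff sum_col by (simp add: mult_ac)
    have mem: "a \<in> V \<Longrightarrow> Inl a \<in> I" "j \<in> J - {k} \<Longrightarrow> Inr (Inl j) \<in> I" "Inr (Inr ()) \<in> I" for a j
      by (auto simp: I_def)
    have finI: "finite I" using finV J by (simp add: I_def)
    have "\<forall>v\<in>V. y v = 0" if y: "\<And>i. i \<in> I \<Longrightarrow> (\<Sum>v\<in>V. y v * M0 i v) = 0" for y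
    proof -
      have ky: "stress_kernel \<omega> y"
      proof (rule kerI)
        fix a assume "a \<in> V"
        then show "(\<Sum>v\<in>V. y v * col \<omega> (indicator {a}) v) = 0"
          using y[OF mem(1), of a] by (simp add: M0_def)
      qed
      have yJ: "y j = 0" if "j \<in> J - {k}" for j
        using y[OF mem(2)[OF that]] that J(1) finV
        by (auto simp: M0_def if_distrib[of "\<lambda>x. _ * x"] cong: if_cong)
      have "0 = B y"
        using y[OF mem(3)] by (simp add: M0_def sum_col B_def)
      also have "\<dots> = B (\<lambda>v. y k * b k v)"
      proof (rule Bcong)
        fix v assume "v \<in> V"
        then have "y v = (\<Sum>j\<in>J. y j * b j v)" by (rule expand[OF ky])
        also have "\<dots> = y k * b k v"
          using J(2) k(1) yJ by (simp add: sum.remove[of J k])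
        finally show "y v = y k * b k v" .
      qed
      also have "\<dots> = y k * B (b k)"
        by (simp add: B_def ediff_scale sum_distrib_left mult_ac)
      finally have "y k = 0" using k(2) by simp
      then show ?thesis using inj[OF ky] yJ by blast
    qed
    note perturbation = injective_perturbation[of I V M0 M1, OF finI finV this]
    obtain e where e: "e > 0" "\<And>t y. \<bar>t\<bar> < e \<Longrightarrow>
        (\<And>i. i \<in> I \<Longrightarrow> (\<Sum>v\<in>V. y v * (M0 i v + t * M1 i v)) = 0) \<Longrightarrow> \<forall>v\<in>V. y v = 0"
      using perturbation by blast
    \<comment> \<open>Steps of this form are rational, so that the set of stresses with polynomial
      entries is closed under them.\<close>
    obtain m where m: "1 / real (Suc m) < e" using e(1) nat_approx_posE by blast
    define r where "r = 1 / real (Suc m)"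
    have r: "\<bar>r\<bar> < e" "r \<noteq> 0" using m by (auto simp: r_def)
    define \<omega>' where "\<omega>' t = \<omega> t + r * \<sigma> t" for t
    have "P \<omega>' (J - {k})"
      unfolding P_def
    proof (intro conjI allI impI)
      fix y assume ky: "stress_kernel \<omega>' y" and yJ: "\<forall>j\<in>J - {k}. y j = 0"
      have split: "(\<Sum>t\<in>T. \<omega> t * ediff t x * ediff t y) + r * (\<Sum>t\<in>T. \<sigma> t * ediff t x * ediff t y) = 0" for x
        using stress_kernelD[OF ky, of x]
        by (simp add: \<omega>'_def algebra_simps sum.distrib sum_distrib_left)
      \<comment> \<open>Testing with \<open>z\<close>, which the Laplacian of
        \<open>\<omega>\<close> kills, leaves only the term of \<open>\<sigma>\<close>; so the row
        \<open>B\<close> needs no perturbation.\<close>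
      have By: "B y = 0"
        using split[of z] stress_kernelD[OF z, of y] r(2) by (simp add: B_def)
      show "\<forall>v\<in>V. y v = 0"
      proof (rule e(2)[OF r(1)])
        fix i assume "i \<in> I"
        then consider a where "i = Inl a" | j where "i = Inr (Inl j)" "j \<in> J - {k}" | "i = Inr (Inr ())"
          by (auto simp: I_def)
        then show "(\<Sum>v\<in>V. y v * (M0 i v + r * M1 i v)) = 0"
        proof cases
          case (1 a)
          have "(\<Sum>v\<in>V. y v * (M0 i v + r * M1 i v)) =
              (\<Sum>v\<in>V. y v * col \<omega> (indicator {a}) v) + r * (\<Sum>v\<in>V. y v * col \<sigma> (indicator {a}) v)"
            by (simp add: 1 M0_def M1_def algebra_simps sum.distrib sum_distrib_left)
          then show ?thesis using split[of "indicator {a}"] by (simp add: sum_col)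
        next
          case (2 j)
          then show ?thesis using J(1) yJ finV
            by (auto simp: M0_def M1_def if_distrib[of "\<lambda>x. _ * x"] cong: if_cong)
        next
          case 3
          then show ?thesis using By by (simp add: M0_def M1_def sum_col B_def)
        qed
      qed
    qed (use J in blast)
    moreover have "\<omega>' \<in> S" using S(2)[OF \<omega>(1) \<sigma>, of m] by (simp add: \<omega>'_def[abs_def] r_def)
    ultimately show False using smaller k(1) by blast
  qed
  then show ?thesis using \<omega>(1) by blast
qed

end

section \<open>Stresses with nontrivial kernel\<close>

context gain_edges
begin

text \<open>By the Fredholm alternative it suffices that every \<open>\<eta>\<close> orthogonal to
  the flex equations and to the kernel equations kills the squared differences. The
  \<open>T\<close>-part of \<open>\<eta>\<close> is the sum of a stress, handled by
  \<open>quad\<close>, and the derivative of \<open>\<omega>\<close> along a suitable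
  derivation.\<close>

lemma squared_edges_in_flex_image:
  assumes free: "free_placement p L" and st: "stress p L \<omega>"
    and quad: "\<And>\<sigma> y. stress p L \<sigma> \<Longrightarrow> stress_kernel \<omega> y \<Longrightarrow> (\<Sum>t\<in>T. \<sigma> t * (ediff t y)\<^sup>2) = 0"
    and z: "\<And>i. stress_kernel \<omega> (z i)"
  shows "\<exists>z'. (\<forall>i. stress_kernel \<omega> (z' i)) \<and>
    (\<forall>t\<in>T. (\<Sum>i\<in>UNIV. evec p L t i * ediff t (z' i)) = (\<Sum>i\<in>UNIV. (ediff t (z i))\<^sup>2))"
proof -
  define Q where "Q v w = (\<Sum>t\<in>T. \<omega> t * ediff t (indicator {v}) * ediff t (indicator {w}))" for v w
  define J where "J = V \<times> (UNIV :: 'd set)"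
  define I where "I = T <+> V \<times> (UNIV :: 'd set)"
  define a :: "'v \<times> 'd \<Rightarrow> ('v, 'd) gain_triple + 'v \<times> 'd \<Rightarrow> real" where
    "a j = case_sum (\<lambda>t. evec p L t (snd j) * ediff t (indicator {fst j}))
       (\<lambda>m. if snd m = snd j then Q (fst j) (fst m) else 0)" for j
  define b :: "('v, 'd) gain_triple + 'v \<times> 'd \<Rightarrow> real" where
    "b = case_sum (\<lambda>t. \<Sum>i\<in>UNIV. (ediff t (z i))\<^sup>2) (\<lambda>_. 0)"
  have fin: "finite J" "finite I" by (auto simp: J_def I_def finV finT)
  have mem: "\<And>t. t \<in> T \<Longrightarrow> Inl t \<in> I" "\<And>v i. v \<in> V \<Longrightarrow> Inr (v, i) \<in> I" "\<And>v i. v \<in> V \<Longrightarrow> (v, i) \<in> J"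
    by (auto simp: I_def J_def)
  have sum_I: "(\<Sum>m\<in>I. f m) = (\<Sum>t\<in>T. f (Inl t)) + (\<Sum>m\<in>V \<times> UNIV. f (Inr m))" for f :: "_ \<Rightarrow> real"
    unfolding I_def by (subst sum.Plus) (auto simp: finT finV)
  have sum_V: "(\<Sum>m\<in>V \<times> UNIV. f m * (if snd m = i then g (fst m) else 0)) = (\<Sum>w\<in>V. f (w, i) * g w)"
    for f :: "'v \<times> 'd \<Rightarrow> real" and g i
    unfolding sum.cartesian_product' by (simp add: if_distrib[of "\<lambda>x. _ * x"] cong: if_cong)
  have "(\<Sum>m\<in>I. \<eta> m * b m) = 0" if \<eta>: "\<And>j. j \<in> J \<Longrightarrow> (\<Sum>m\<in>I. \<eta> m * a j m) = 0" for \<eta>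
  proof -
    define \<psi> where "\<psi> i w = \<eta> (Inr (w, i))" for i w
    have bal: "balanced (\<lambda>t. \<eta> (Inl t) * evec p L t i + \<omega> t * ediff t (\<psi> i))" for i
      unfolding balanced_iff
    proof
      fix v assume v: "v \<in> V"
      have "(\<Sum>w\<in>V. \<eta> (Inr (w, i)) * Q v w) = (\<Sum>t\<in>T. \<omega> t * ediff t (indicator {v}) * ediff t (\<psi> i))"
        unfolding Q_def \<psi>_def by (rule sum_indicators)
      moreover have "(\<Sum>t\<in>T. \<eta> (Inl t) * (evec p L t i * ediff t (indicator {v}))) +
          (\<Sum>w\<in>V. \<eta> (Inr (w, i)) * Q v w) = 0"
        using \<eta>[OF mem(3)[OF v], of i] by (simp add: sum_I a_def sum_V[of "\<lambda>m. \<eta> (Inr m)"])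
      ultimately show "(\<Sum>t\<in>T. (\<eta> (Inl t) * evec p L t i + \<omega> t * ediff t (\<psi> i)) * ediff t (indicator {v})) = 0"
        by (simp add: algebra_simps sum.distrib)
    qed
    \<comment> \<open>Moving \<open>p\<close> along the vertex part \<open>\<psi>\<close> of
      \<open>\<eta>\<close> produces in the differentiated stress equation the same term
      \<open>\<omega> t * ediff t (\<psi> i)\<close> as in \<open>bal\<close>; subtraction leaves a
      stress.\<close>
    obtain D where D: "derivation D" and Dev: "\<forall>t\<in>T. \<forall>i. D (evec p L t i) = ediff t (\<psi> i)"
      using free_placement_derivation[OF free, of \<psi>] by blast
    have "stress p L (\<lambda>t. \<eta> (Inl t) - D (\<omega> t))"
      unfolding stress_def
    proof
      fix i
      have "balanced (\<lambda>t. D (\<omega> t * evec p L t i))"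
        using st by (intro balanced_derivation[OF D]) (simp add: stress_def)
      with bal have "balanced (\<lambda>t. (\<eta> (Inl t) * evec p L t i + \<omega> t * ediff t (\<psi> i)) - D (\<omega> t * evec p L t i))"
        by (intro balanced_diff)
      moreover have "(\<eta> (Inl t) * evec p L t i + \<omega> t * ediff t (\<psi> i)) - D (\<omega> t * evec p L t i) =
          (\<eta> (Inl t) - D (\<omega> t)) * evec p L t i" if "t \<in> T" for t
        using Dev that by (simp add: derivation_mult[OF D] algebra_simps)
      ultimately show "balanced (\<lambda>t. (\<eta> (Inl t) - D (\<omega> t)) * evec p L t i)"
        by (subst balanced_cong) (auto simp: algebra_simps)
    qed
    from quad[OF this z] have 1: "(\<Sum>t\<in>T. (\<eta> (Inl t) - D (\<omega> t)) * (ediff t (z i))\<^sup>2) = 0" for i .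
    \<comment> \<open>The kernel equation of \<open>z i\<close> is differentiated and tested with
      \<open>z i\<close> itself; the other term vanishes by the kernel equation.\<close>
    have 2: "(\<Sum>t\<in>T. D (\<omega> t) * (ediff t (z i))\<^sup>2) = 0" for i
    proof -
      have "balanced (\<lambda>t. D (\<omega> t * ediff t (z i)))"
        using z[of i] by (intro balanced_derivation[OF D]) (simp add: stress_kernel_def)
      from balancedD[OF this, of "z i"]
      have "(\<Sum>t\<in>T. \<omega> t * ediff t (z i) * ediff t (\<lambda>v. D (z i v))) + (\<Sum>t\<in>T. D (\<omega> t) * (ediff t (z i))\<^sup>2) = 0"
        by (simp add: derivation_mult[OF D] derivation_ediff[OF D] sum.distrib
            power2_eq_square algebra_simps)
      then show ?thesis by (simp add: stress_kernelD[OF z])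
    qed
    have "(\<Sum>t\<in>T. \<eta> (Inl t) * (\<Sum>i\<in>UNIV. (ediff t (z i))\<^sup>2)) =
        (\<Sum>i\<in>UNIV. \<Sum>t\<in>T. \<eta> (Inl t) * (ediff t (z i))\<^sup>2)"
      unfolding sum_distrib_left by (rule sum.swap)
    also have "\<dots> = 0"
      using 1 2 by (simp add: left_diff_distrib sum_subtractf)
    finally show ?thesis by (simp add: sum_I b_def)
  qed
  from solvable_if_orthogonal[of J I a b, OF fin this]
  obtain c where c: "\<And>m. m \<in> I \<Longrightarrow> b m = (\<Sum>j\<in>J. c j * a j m)" by blast
  define z' where "z' i v = c (v, i)" for i v
  have "(\<Sum>i\<in>UNIV. evec p L t i * ediff t (z' i)) = (\<Sum>i\<in>UNIV. (ediff t (z i))\<^sup>2)" if t: "t \<in> T" for t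
  proof -
    have "(\<Sum>i\<in>UNIV. (ediff t (z i))\<^sup>2) = (\<Sum>i\<in>UNIV. \<Sum>v\<in>V. evec p L t i * (z' i v * ediff t (indicator {v})))"
      using c[OF mem(1)[OF t]] unfolding J_def sum.cartesian_product'
      by (subst sum.swap) (simp add: a_def b_def z'_def mult_ac)
    then show ?thesis by (simp add: sum_distrib_left[symmetric] ediff_indicators[OF t])
  qed
  moreover have "stress_kernel \<omega> (z' i)" for i
    unfolding stress_kernel_def balanced_iff
  proof
    fix w assume w: "w \<in> V"
    have "0 = (\<Sum>j\<in>V \<times> UNIV. c j * (if snd j = i then Q (fst j) w else 0))"
      using c[OF mem(2)[OF w, of i]] by (simp add: a_def b_def J_def eq_commute[of i] cong: if_cong)
    also have "\<dots> = (\<Sum>v\<in>V. z' i v * (\<Sum>t\<in>T. \<omega> t * ediff t (indicator {w}) * ediff t (indicator {v})))"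
      unfolding sum_V[of c i "\<lambda>v. Q v w"] by (simp add: z'_def Q_def mult_ac)
    also have "\<dots> = (\<Sum>t\<in>T. \<omega> t * ediff t (indicator {w}) * ediff t (z' i))"
      by (rule sum_indicators)
    finally show "(\<Sum>t\<in>T. \<omega> t * ediff t (z' i) * ediff t (indicator {w})) = 0"
      by (simp add: mult_ac)
  qed
  ultimately show ?thesis by blast
qed

text \<open>
  If \<open>R\<close> is the linear part of the length map on the kernel of the stress, the squared lengths lie in the
  image of \<open>R\<close>; so \<open>c \<mapsto> q(R\<^sup>-\<^sup>1 c)\<close> is a quadratic self-map with nonnegative coordinates, and an
  eigenvector of it, suitably scaled, is a displacement that preserves all edge lengths.
\<close>

lemma equivalent_displacement_exists:
  assumes free: "free_placement p L" and st: "stress p L \<omega>"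
    and quad: "\<And>\<sigma> y. stress p L \<sigma> \<Longrightarrow> stress_kernel \<omega> y \<Longrightarrow> (\<Sum>t\<in>T. \<sigma> t * (ediff t y)\<^sup>2) = 0"
    and \<kappa>: "stress_kernel \<omega> \<kappa>" "\<not> const_on_V \<kappa>"
  shows "\<exists>z i. \<not> const_on_V (z i) \<and>
    (\<forall>t\<in>T. 2 * (\<Sum>i\<in>UNIV. evec p L t i * ediff t (z i)) + (\<Sum>i\<in>UNIV. (ediff t (z i))\<^sup>2) = 0)"
proof -
  obtain k :: 'd where True by blast
  define z0 where "z0 i = (if i = k then \<kappa> else (\<lambda>_. 0))" for i
  have z0k: "z0 k = \<kappa>" by (simp add: z0_def)
  define q where "q z t = (\<Sum>i\<in>UNIV. (ediff t (z i))\<^sup>2)" for z :: "'d \<Rightarrow> 'v \<Rightarrow> real" and t :: "('v, 'd) gain_triple"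
  define R where "R z t = (\<Sum>i\<in>UNIV. evec p L t i * ediff t (z i))" for z t
  have q0: "q z t = 0 \<longleftrightarrow> (\<forall>i. ediff t (z i) = 0)" for z t
    by (simp add: q_def sum_nonneg_eq_0_iff)
  show ?thesis
  proof (cases "\<forall>t\<in>T. q z0 t = 0")
    \<comment> \<open>\<open>z0\<close> changes no edge vector, so the given kernel vector, placed
      in a single coordinate direction, already works.\<close>
    case True
    then have "\<forall>t\<in>T. \<forall>i. ediff t (z0 i) = 0" by (simp add: q0)
    then show ?thesis using \<kappa>(2) z0k by (intro exI[of _ z0] exI[of _ k]) auto
  next
    case False
    define Z where "Z = {z :: 'd \<Rightarrow> 'v \<Rightarrow> real. \<forall>i. stress_kernel \<omega> (z i)}"
    have "stress_kernel \<omega> (\<lambda>_. 0)" using stress_kernel_scale[OF \<kappa>(1), of 0] by simp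
    then have z0: "z0 \<in> Z" using \<kappa>(1) by (simp add: Z_def z0_def)
    have R_comb: "R (\<lambda>i v. \<Sum>m\<in>A. c m * y m i v) t = (\<Sum>m\<in>A. c m * R (y m) t)"
      for A :: "nat set" and c y t
      unfolding R_def ediff_sum ediff_scale sum_distrib_left by (subst sum.swap) (simp add: mult_ac)
    have R_scale: "R (\<lambda>i v. r * y i v) t = r * R y t" for r y t
      by (simp add: R_def ediff_scale sum_distrib_left mult_ac)
    have R_diff: "R (\<lambda>i v. x i v - y i v) t = R x t - R y t" for x y t
      by (simp add: R_def ediff_diff right_diff_distrib sum_subtractf)
    have qR: "\<exists>z'\<in>Z. \<forall>t\<in>T. R z' t = q z t" if "z \<in> Z" for z
      using squared_edges_in_flex_image[OF free st quad, of z] that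
      unfolding Z_def R_def q_def by blast
    \<comment> \<open>A smallest such set of edges will supply coordinates on the image of
      \<open>Z\<close> under \<open>R\<close>.\<close>
    define P where "P J \<longleftrightarrow> J \<subseteq> T \<and> (\<forall>z\<in>Z. (\<forall>j\<in>J. R z j = 0) \<longrightarrow> (\<forall>t\<in>T. R z t = 0))" for J
    have "P T" by (auto simp: P_def)
    then have ex: "\<exists>n. \<exists>J. P J \<and> card J = n" by blast
    define n where "n = (LEAST n. \<exists>J. P J \<and> card J = n)"
    obtain J where J: "P J" "card J = n"
      using LeastI_ex[OF ex] unfolding n_def by blast
    have least: "n \<le> card J'" if "P J'" for J'
      unfolding n_def by (rule Least_le) (use that in blast)
    have JT: "J \<subseteq> T" and finJ: "finite J"
      using J(1) finT finite_subset unfolding P_def by blast+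
    have inj: "\<forall>t\<in>T. R z t = 0" if "z \<in> Z" "\<forall>j\<in>J. R z j = 0" for z
      using J(1) that unfolding P_def by blast
    \<comment> \<open>Since \<open>q z\<close> lies in the image of \<open>R\<close>, its equality
      with a multiple of \<open>R y\<close> on \<open>J\<close> extends to all of
      \<open>T\<close>.\<close>
    have inj_q: "\<forall>t\<in>T. q z t = r * R y t"
      if zy: "z \<in> Z" "y \<in> Z" "\<forall>j\<in>J. q z j = r * R y j" for z y r
    proof -
      obtain z' where z': "z' \<in> Z" "\<forall>t\<in>T. R z' t = q z t" using qR zy(1) by blast
      define x where "x = (\<lambda>i v. z' i v - r * y i v)"
      have "x \<in> Z" using z'(1) zy(2) unfolding x_def Z_def
        by (auto intro!: stress_kernel_diff stress_kernel_scale)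
      moreover have Rx: "R x t = R z' t - r * R y t" for t
        by (simp add: x_def R_diff R_scale)
      moreover have "R x j = 0" if j: "j \<in> J" for j
        using z'(2) zy(3) j JT unfolding Rx by (metis subsetD right_minus_eq)
      ultimately have Rx0: "\<forall>t\<in>T. R x t = 0" using inj[of x] by blast
      show ?thesis
      proof
        fix t assume "t \<in> T"
        with Rx0 z'(2) show "q z t = r * R y t" unfolding Rx by force
      qed
    qed
    have "J \<noteq> {}"
    proof
      assume "J = {}"
      then have "\<forall>t\<in>T. q z0 t = 0 * R z0 t" using inj_q[OF z0 z0, of 0] by blast
      with False show False by simp
    qed
    have "\<exists>b. \<forall>j\<in>J. b j \<in> R ` Z \<and> (\<forall>i\<in>J. b j i = (if i = j then 1 else 0))"
    proof (rule coordinate_dual_basis[of _ J T])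
      fix w r assume "w \<in> R ` Z"
      then obtain y where y: "y \<in> Z" "w = R y" by blast
      have "(\<lambda>i v. r * y i v) \<in> Z" using y(1) stress_kernel_scale by (simp add: Z_def)
      moreover have "R (\<lambda>i v. r * y i v) = (\<lambda>t. r * w t)" by (simp add: fun_eq_iff y(2) R_scale)
      ultimately show "(\<lambda>t. r * w t) \<in> R ` Z" by (metis imageI)
    next
      fix w assume "w \<in> R ` Z" "\<And>j. j \<in> J \<Longrightarrow> w j = 0"
      then show "\<forall>t\<in>T. w t = 0" using inj by blast
    next
      fix j assume j: "j \<in> J"
      have "\<not> P (J - {j})"
        using least[of "J - {j}"] J(2) card_Diff1_less[OF finJ j] by auto
      then show "\<exists>w\<in>R ` Z. (\<forall>i\<in>J - {j}. w i = 0) \<and> \<not> (\<forall>t\<in>T. w t = 0)"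
        using JT unfolding P_def by blast
    qed
    then obtain b where b: "\<And>j. j \<in> J \<Longrightarrow> b j \<in> R ` Z"
      "\<And>i j. i \<in> J \<Longrightarrow> j \<in> J \<Longrightarrow> b j i = (if i = j then 1 else 0)"
      by blast
    have "\<forall>j\<in>J. \<exists>y. y \<in> Z \<and> R y = b j" using b(1) by fastforce
    from bchoice[OF this] obtain B where B: "\<And>j. j \<in> J \<Longrightarrow> B j \<in> Z" "\<And>j. j \<in> J \<Longrightarrow> R (B j) = b j"
      by blast
    \<comment> \<open>The coordinates of the eigenvector lemma run from 0 to \<open>N\<close>, hence
      the shift by one.\<close>
    obtain N where N: "card J = Suc N"
      using \<open>J \<noteq> {}\<close> finJ by (metis card_0_eq not0_implies_Suc)
    obtain h where h: "bij_betw h {..N} J"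
      using ex_bij_betw_nat_finite[OF finJ] N by (metis atLeast0LessThan lessThan_Suc_atMost)
    have hJ: "h m \<in> J" if "m \<le> N" for m using h that by (auto simp: bij_betw_def)
    have h_eq: "h m = h l \<longleftrightarrow> m = l" if "m \<le> N" "l \<le> N" for m l
      using h that by (auto simp: bij_betw_def inj_on_def)
    have hsurj: "\<exists>m\<le>N. j = h m" if "j \<in> J" for j
      using h that by (auto simp: bij_betw_def)
    \<comment> \<open>A linear section of \<open>R\<close>: on \<open>J\<close>, enumerated by
      \<open>h\<close>, \<open>R (z x)\<close> has the coordinates \<open>x\<close>.\<close>
    define z where "z x i v = (\<Sum>m\<le>N. x m * B (h m) i v)" for x i v
    have zZ: "z x \<in> Z" for x
      using B(1)[OF hJ] unfolding z_def Z_def by (auto intro!: stress_kernel_combination)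
    have Rz: "R (z x) (h m) = x m" if m: "m \<le> N" for x m
    proof -
      have "R (z x) (h m) = (\<Sum>l\<le>N. x l * R (B (h l)) (h m))"
        unfolding z_def by (rule R_comb)
      also have "\<dots> = (\<Sum>l\<le>N. x l * (if m = l then 1 else 0))"
        using m by (intro sum.cong refl) (simp add: B(2) hJ b(2) h_eq)
      also have "\<dots> = x m" using m by (simp add: if_distrib[of "\<lambda>x. _ * x"] cong: if_cong)
      finally show ?thesis .
    qed
    define \<phi> where "\<phi> x m = q (z x) (h m)" for x m
    have cont: "continuous_on UNIV (\<lambda>x. \<phi> x m)" for m
      unfolding \<phi>_def q_def z_def ediff_def
      by (intro continuous_intros continuous_on_product_coordinates)
    have nz: "\<exists>m\<le>N. \<phi> x m \<noteq> 0" if x: "\<exists>m\<le>N. x m \<noteq> 0" for x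
    proof (rule ccontr)
      assume "\<not> ?thesis"
      then have q0J: "q (z x) (h m) = 0" if "m \<le> N" for m using that by (simp add: \<phi>_def)
      have "q (z x) j = 0 * R (z x) j" if j: "j \<in> J" for j
        using hsurj[OF j] q0J by auto
      then have "\<forall>t\<in>T. q (z x) t = 0" using inj_q[OF zZ zZ, of x 0 x] by simp
      then have "\<forall>t\<in>T. R (z x) t = 0" by (simp add: q0 R_def)
      then have "x m = 0" if "m \<le> N" for m
        using Rz[OF that, of x] subsetD[OF JT hJ[OF that]] by metis
      with x show False by blast
    qed
    have "\<exists>x l. l > 0 \<and> (\<exists>m\<le>N. x m \<noteq> 0) \<and> (\<forall>m\<le>N. \<phi> x m = l * x m)"
      by (rule nonneg_map_eigenvector[of N \<phi>]) (use cont nz in \<open>auto simp: \<phi>_def q_def sum_nonneg\<close>)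
    then obtain x l where x: "l > 0" "\<exists>m\<le>N. x m \<noteq> 0" "\<And>m. m \<le> N \<Longrightarrow> \<phi> x m = l * x m" by blast
    have "q (z x) j = l * R (z x) j" if j: "j \<in> J" for j
      using hsurj[OF j] x(3) Rz unfolding \<phi>_def by auto
    then have eig: "q (z x) t = l * R (z x) t" if "t \<in> T" for t using inj_q[OF zZ zZ] that by blast
    \<comment> \<open>Scaling \<open>z x\<close> by \<open>s\<close> turns \<open>2 R + q\<close>
      into \<open>s * (2 + s * l) * R (z x)\<close>, which this value annihilates.\<close>
    define s where "s = - 2 / l"
    have "s \<noteq> 0" using x(1) by (simp add: s_def)
    define y where "y = (\<lambda>i v. s * z x i v)"
    have "2 * R y t + q y t = 0" if "t \<in> T" for t
    proof -
      have "R y t = s * R (z x) t" unfolding y_def by (rule R_scale)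
      moreover have "q y t = s\<^sup>2 * q (z x) t"
        by (simp add: q_def y_def ediff_scale power_mult_distrib sum_distrib_left)
      ultimately have "2 * R y t + q y t = s * (2 + s * l) * R (z x) t"
        using eig[OF that] by (simp add: algebra_simps power2_eq_square)
      then show ?thesis using x(1) by (simp add: s_def)
    qed
    moreover have "\<exists>i. \<not> const_on_V (y i)"
    proof (rule ccontr)
      assume "\<not> ?thesis"
      then have ye: "ediff t (y i) = 0" if "t \<in> T" for t i using ediff_const_on_V that by blast
      have "ediff t (z x i) = 0" if "t \<in> T" for t i
        using ye[OF that, of i] \<open>s \<noteq> 0\<close> by (simp add: y_def ediff_scale)
      then have "R (z x) t = 0" if "t \<in> T" for t using that by (simp add: R_def)
      then have "x m = 0" if "m \<le> N" for m
        using Rz[OF that, of x] subsetD[OF JT hJ[OF that]] by metis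
      with x(2) show False by blast
    qed
    ultimately show ?thesis unfolding R_def q_def by blast
  qed
qed

end

section \<open>The dichotomy\<close>

text \<open>The ring \<open>\<rat>[x]\<close>, which plays the role of \<open>K\<close> in
  \<open>linear_descent\<close>.\<close>

definition polyvalues :: "'i set \<Rightarrow> ('i \<Rightarrow> real) \<Rightarrow> real set" where
  "polyvalues I x = (\<lambda>g. g x) ` rat_polyfuns I"

lemma polyvaluesI: "g \<in> rat_polyfuns I \<Longrightarrow> g x = a \<Longrightarrow> a \<in> polyvalues I x"
  by (auto simp: polyvalues_def)

lemma polyvaluesE: "a \<in> polyvalues I x \<Longrightarrow> \<exists>g. g \<in> rat_polyfuns I \<and> g x = a"
  by (auto simp: polyvalues_def)

lemma polyvalues_of_rat: "of_rat r \<in> polyvalues I x"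
  by (rule polyvaluesI[OF rat_polyfuns_const]) simp

lemma polyvalues_one: "1 \<in> polyvalues I x"
  using polyvalues_of_rat[of 1] by simp

lemma polyvalues_add: "a \<in> polyvalues I x \<Longrightarrow> b \<in> polyvalues I x \<Longrightarrow> a + b \<in> polyvalues I x"
  using rat_polyfuns_add by (fastforce simp: polyvalues_def)

lemma polyvalues_diff: "a \<in> polyvalues I x \<Longrightarrow> b \<in> polyvalues I x \<Longrightarrow> a - b \<in> polyvalues I x"
  using rat_polyfuns_diff by (fastforce simp: polyvalues_def)

lemma polyvalues_mult: "a \<in> polyvalues I x \<Longrightarrow> b \<in> polyvalues I x \<Longrightarrow> a * b \<in> polyvalues I x"
  using rat_polyfuns_mult by (fastforce simp: polyvalues_def)

lemma rat_polyfuns_ediff_indicator: "(\<lambda>_. ediff t (indicator {v})) \<in> rat_polyfuns I"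
proof -
  have "ediff t (indicator {v}) = of_int (of_bool (fst (snd t) = v) - of_bool (fst t = v))"
    by (simp add: ediff_def indicator_def)
  then show ?thesis by (simp only: rat_polyfuns_of_int)
qed

lemma polyvalues_ediff_indicator: "ediff t (indicator {v}) \<in> polyvalues I x"
  by (rule polyvaluesI[OF rat_polyfuns_ediff_indicator]) simp

definition evec_polyfun ::
  "('v, 'd::finite) gain_triple \<Rightarrow> 'd \<Rightarrow> ('v \<times> 'd + 'd \<times> 'd \<Rightarrow> real) \<Rightarrow> real" where
  "evec_polyfun t i x = x (Inl (fst (snd t), i)) - x (Inl (fst t, i)) +
     (\<Sum>j\<in>UNIV. x (Inr (i, j)) * of_int (snd (snd t) $ j))"

lemma evec_polyfun_framework_coords: "evec_polyfun t i (framework_coords p L) = evec p L t i"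
  by (simp add: evec_polyfun_def evec_def ediff_def framework_coords_def)

text \<open>The determinant is a rational polynomial in the coordinates; vanishing at a generic
  point, it would vanish at the identity matrix as well.\<close>

lemma generic_framework_det_nonzero:
  fixes p :: "'v \<Rightarrow> real ^ 'd" and L :: "real ^ 'd ^ 'd"
  assumes "generic_framework V p L"
  shows "det L \<noteq> 0"
proof
  assume L0: "det L = 0"
  define g :: "('v \<times> 'd + 'd \<times> 'd \<Rightarrow> real) \<Rightarrow> real" where
    "g = (\<lambda>x. \<Sum>\<pi> | \<pi> permutes UNIV. of_int (sign \<pi>) * (\<Prod>i\<in>UNIV. x (Inr (i, \<pi> i))))"
  have g: "g (framework_coords p A) = det A" for A :: "real ^ 'd ^ 'd"
    by (simp add: g_def framework_coords_def det_def)
  have "g \<in> rat_polyfuns ((V \<times> UNIV) <+> UNIV)"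
    unfolding g_def
    by (intro rat_polyfuns_sum rat_polyfuns_mult rat_polyfuns_of_int rat_polyfuns_prod rat_polyfuns_var InrI UNIV_I)
  then have "g (framework_coords p (mat 1)) = 0"
    by (rule algebraically_independent_vanishing[OF assms[unfolded generic_framework_def]])
       (simp add: g L0)
  then show False by (simp add: g)
qed

context gain_edges
begin

abbreviation coords :: "('v \<times> 'd + 'd \<times> 'd) set" where
  "coords \<equiv> (V \<times> UNIV) <+> UNIV"

text \<open>Entries in \<open>\<rat>[p, L]\<close> can be evaluated again at any other generic
  framework.\<close>

definition polynomial_stress :: "('v \<Rightarrow> real ^ 'd) \<Rightarrow> real ^ 'd ^ 'd \<Rightarrow> (('v, 'd) gain_triple \<Rightarrow> real) \<Rightarrow> bool" where
  "polynomial_stress p L \<omega> \<longleftrightarrow>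
     stress p L \<omega> \<and> (\<forall>t\<in>T. \<omega> t \<in> polyvalues coords (framework_coords p L))"

lemma rat_polyfuns_evec_polyfun: "t \<in> T \<Longrightarrow> evec_polyfun t i \<in> rat_polyfuns coords"
  unfolding evec_polyfun_def[abs_def] using ends[of t]
  by (intro rat_polyfuns_add rat_polyfuns_diff rat_polyfuns_sum rat_polyfuns_mult rat_polyfuns_of_int
      rat_polyfuns_var) auto

lemma polyvalues_evec: "t \<in> T \<Longrightarrow> evec p L t i \<in> polyvalues coords (framework_coords p L)"
  using evec_polyfun_framework_coords by (intro polyvaluesI[OF rat_polyfuns_evec_polyfun])

lemma free_placement_if_generic:
  assumes "generic_framework V p L"
  shows "free_placement p L"
  unfolding free_placement_def
proof
  fix \<psi> :: "'d \<Rightarrow> 'v \<Rightarrow> real"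
  obtain D where D: "derivation D"
    "\<And>i. i \<in> coords \<Longrightarrow> D (framework_coords p L i) = case_sum (\<lambda>(v, i). \<psi> i v) (\<lambda>_. 0) i"
    using derivation_with_values[OF assms[unfolded generic_framework_def],
        of "case_sum (\<lambda>(v, i). \<psi> i v) (\<lambda>_. 0)"] by metis
  have "D (L $ i $ j) = 0" for i j
    using D(2)[OF InrI[OF UNIV_I], of "(i, j)"] by (simp add: framework_coords_def)
  moreover have "D (p v $ i) = \<psi> i v" if "v \<in> V" for v i
    using D(2)[OF InlI, of "(v, i)"] that by (simp add: framework_coords_def)
  ultimately show "\<exists>D. derivation D \<and> (\<forall>i j. D (L $ i $ j) = 0) \<and> (\<forall>v\<in>V. \<forall>i. D (p v $ i) = \<psi> i v)"
    using D(1) by blast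
qed

text \<open>The stress equations have coefficients in \<open>\<rat>[p, L]\<close>, so
  \<open>linear_descent\<close> writes a nonzero multiple of \<open>\<sigma>\<close> as a real
  combination of polynomial stresses, and the claim is linear in \<open>\<sigma>\<close>.\<close>

lemma stress_quadratic_vanishing:
  assumes pol: "\<And>\<sigma>. polynomial_stress p L \<sigma> \<Longrightarrow> (\<Sum>t\<in>T. \<sigma> t * (ediff t y)\<^sup>2) = 0"
    and st: "stress p L \<sigma>"
  shows "(\<Sum>t\<in>T. \<sigma> t * (ediff t y)\<^sup>2) = 0"
proof -
  let ?K = "polyvalues coords (framework_coords p L)"
  have "\<exists>M d c. M \<subseteq> T \<and> d \<noteq> 0 \<and> (\<forall>j\<in>T. \<forall>l\<in>M. c j l \<in> ?K) \<and>
    (\<forall>j\<in>T. d * \<sigma> j = (\<Sum>l\<in>M. c j l * \<sigma> l)) \<and>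
    (\<forall>a. (\<forall>j\<in>T. a j \<in> ?K) \<longrightarrow> (\<Sum>j\<in>T. a j * \<sigma> j) = 0 \<longrightarrow> (\<forall>l\<in>M. (\<Sum>j\<in>T. a j * c j l) = 0))"
    by (rule linear_descent) (auto intro: polyvalues_one polyvalues_diff polyvalues_mult finT)
  then obtain M d c where M: "d \<noteq> 0" "\<forall>t\<in>T. \<forall>l\<in>M. c t l \<in> ?K"
    "\<forall>t\<in>T. d * \<sigma> t = (\<Sum>l\<in>M. c t l * \<sigma> l)"
    and rel: "\<forall>a. (\<forall>t\<in>T. a t \<in> ?K) \<longrightarrow> (\<Sum>t\<in>T. a t * \<sigma> t) = 0 \<longrightarrow> (\<forall>l\<in>M. (\<Sum>t\<in>T. a t * c t l) = 0)"
    by blast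
  have "polynomial_stress p L (\<lambda>t. c t l)" if l: "l \<in> M" for l
    unfolding polynomial_stress_def stress_def balanced_iff
  proof (intro conjI allI ballI)
    fix i v assume "v \<in> V"
    let ?a = "\<lambda>t. evec p L t i * ediff t (indicator {v})"
    have "\<forall>t\<in>T. ?a t \<in> ?K"
      by (intro ballI polyvalues_mult polyvalues_evec polyvalues_ediff_indicator)
    moreover have "(\<Sum>t\<in>T. ?a t * \<sigma> t) = 0"
      using stressD[OF st, of i "indicator {v}"] by (simp add: mult_ac)
    ultimately have "(\<Sum>t\<in>T. ?a t * c t l) = 0" using rel[rule_format, of ?a l] l by blast
    then show "(\<Sum>t\<in>T. c t l * evec p L t i * ediff t (indicator {v})) = 0"
      by (simp add: mult_ac)
  qed (use M(2) l in auto)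
  note ps = this
  have "d * (\<Sum>t\<in>T. \<sigma> t * (ediff t y)\<^sup>2) = (\<Sum>t\<in>T. (d * \<sigma> t) * (ediff t y)\<^sup>2)"
    by (simp add: sum_distrib_left mult_ac)
  also have "\<dots> = (\<Sum>t\<in>T. (\<Sum>l\<in>M. c t l * \<sigma> l) * (ediff t y)\<^sup>2)"
    using M(3) by (intro sum.cong refl) metis
  also have "\<dots> = (\<Sum>l\<in>M. \<sigma> l * (\<Sum>t\<in>T. c t l * (ediff t y)\<^sup>2))"
    unfolding sum_distrib_left sum_distrib_right by (subst sum.swap) (simp add: mult_ac)
  also have "\<dots> = 0" using pol[OF ps] by simp
  finally show ?thesis using M(1) by simp
qed

text \<open>The stress equations are polynomial identities, so evaluating the entries of
  \<open>\<omega>\<close> at the other framework gives a stress \<open>\<omega>'\<close>. A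
  nonconstant kernel vector of \<open>\<omega>'\<close> could be replaced by one with polynomial
  entries and carried back, contradicting \<open>ker\<close>.\<close>

lemma trivial_stress_kernel_transfer:
  assumes gen: "generic_framework V p L" and gen': "generic_framework V p' L'"
    and st: "polynomial_stress p L \<omega>"
    and ker: "\<And>z. stress_kernel \<omega> z \<Longrightarrow> const_on_V z"
  shows "\<exists>\<omega>'. stress p' L' \<omega>' \<and> (\<forall>z. stress_kernel \<omega>' z \<longrightarrow> const_on_V z)"
proof -
  define x x' where "x = framework_coords p L" and "x' = framework_coords p' L'"
  note vanish = algebraically_independent_vanishing[OF gen[unfolded generic_framework_def x_def[symmetric]]]
    and vanish' = algebraically_independent_vanishing[OF gen'[unfolded generic_framework_def x'_def[symmetric]]]
  have "\<forall>t\<in>T. \<exists>g. g \<in> rat_polyfuns coords \<and> g x = \<omega> t"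
    using st polyvaluesE unfolding polynomial_stress_def x_def by blast
  from bchoice[OF this] obtain g where
    g: "\<And>t. t \<in> T \<Longrightarrow> g t \<in> rat_polyfuns coords" "\<And>t. t \<in> T \<Longrightarrow> g t x = \<omega> t" by blast
  define \<omega>' where "\<omega>' t = g t x'" for t
  have "stress p' L' \<omega>'"
    unfolding stress_def balanced_iff
  proof (intro allI ballI)
    fix i v assume "v \<in> V"
    define F where "F = (\<lambda>x. \<Sum>t\<in>T. g t x * evec_polyfun t i x * ediff t (indicator {v}))"
    have "F \<in> rat_polyfuns coords"
      unfolding F_def
      by (intro rat_polyfuns_sum rat_polyfuns_mult g(1) rat_polyfuns_evec_polyfun rat_polyfuns_ediff_indicator)
    moreover have "F x = 0"
      using st unfolding F_def x_def evec_polyfun_framework_coords polynomial_stress_def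
      by (simp add: g(2)[unfolded x_def] stressD)
    ultimately have "F x' = 0" by (rule vanish)
    then show "(\<Sum>t\<in>T. \<omega>' t * evec p' L' t i * ediff t (indicator {v})) = 0"
      by (simp add: F_def \<omega>'_def x'_def evec_polyfun_framework_coords)
  qed
  moreover have "const_on_V z" if z: "stress_kernel \<omega>' z" for z
  proof (rule ccontr)
    assume "\<not> const_on_V z"
    then obtain v1 where v1: "v1 \<in> V" "z v1 \<noteq> z v0" by blast
    \<comment> \<open>With this normalization \<open>y v0 = 0\<close> is a linear relation and
      passes to each column of \<open>c\<close>, so that a nonzero value at \<open>v1\<close> alone
      witnesses nonconstancy.\<close>
    define y where "y v = z v - z v0" for v
    have y: "stress_kernel \<omega>' y"
      using z by (simp add: stress_kernel_def y_def[abs_def] ediff_diff ediff_const)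
    let ?K = "polyvalues coords x'"
    have "\<exists>M d c. M \<subseteq> V \<and> d \<noteq> 0 \<and> (\<forall>j\<in>V. \<forall>l\<in>M. c j l \<in> ?K) \<and>
      (\<forall>j\<in>V. d * y j = (\<Sum>l\<in>M. c j l * y l)) \<and>
      (\<forall>a. (\<forall>j\<in>V. a j \<in> ?K) \<longrightarrow> (\<Sum>j\<in>V. a j * y j) = 0 \<longrightarrow> (\<forall>l\<in>M. (\<Sum>j\<in>V. a j * c j l) = 0))"
      by (rule linear_descent) (auto intro: polyvalues_one polyvalues_diff polyvalues_mult finV)
    then obtain M d c where M: "d \<noteq> 0" "\<forall>v\<in>V. \<forall>l\<in>M. c v l \<in> ?K"
      "\<forall>v\<in>V. d * y v = (\<Sum>l\<in>M. c v l * y l)"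
      and rel: "\<forall>a. (\<forall>v\<in>V. a v \<in> ?K) \<longrightarrow> (\<Sum>v\<in>V. a v * y v) = 0 \<longrightarrow> (\<forall>l\<in>M. (\<Sum>v\<in>V. a v * c v l) = 0)"
      by blast
    have "d * y v1 \<noteq> 0" using M(1) v1(2) by (simp add: y_def)
    then have "(\<Sum>l\<in>M. c v1 l * y l) \<noteq> 0" using M(3) v1(1) by metis
    then obtain l where l: "l \<in> M" "c v1 l * y l \<noteq> 0" by (rule sum.not_neutral_contains_not_neutral)
    have "\<forall>w\<in>V. \<exists>h. h \<in> rat_polyfuns coords \<and> h x' = c w l"
      using M(2) l(1) polyvaluesE by blast
    from bchoice[OF this] obtain h where
      h: "\<And>w. w \<in> V \<Longrightarrow> h w \<in> rat_polyfuns coords" "\<And>w. w \<in> V \<Longrightarrow> h w x' = c w l" by blast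
    have "(\<Sum>w\<in>V. (if w = v0 then 1 else 0) * y w) = 0"
      using finV v0 by (simp add: if_distrib[of "\<lambda>x. x * _"] y_def cong: if_cong)
    moreover have "\<forall>w\<in>V. (if w = v0 then 1 else 0) \<in> ?K"
      using polyvalues_one[of coords x'] polyvalues_of_rat[of 0 coords x'] by simp
    ultimately have "(\<Sum>w\<in>V. (if w = v0 then 1 else 0) * c w l) = 0"
      using rel[rule_format, of "\<lambda>w. if w = v0 then 1 else 0" l] l(1) by blast
    then have "h v0 x' = 0"
      using finV v0 by (simp add: h(2) if_distrib[of "\<lambda>x. x * _"] cong: if_cong)
    then have h0: "h v0 x = 0" using vanish' h(1)[OF v0] by blast
    \<comment> \<open>The kernel equations hold for the polynomials \<open>h\<close> at
      \<open>x'\<close>, hence identically, and are evaluated at \<open>x\<close>.\<close>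
    have "stress_kernel \<omega> (\<lambda>w. h w x)"
      unfolding stress_kernel_def balanced_iff
    proof
      fix v assume "v \<in> V"
      define a where "a w = (\<lambda>x. \<Sum>t\<in>T. g t x * ediff t (indicator {v}) * ediff t (indicator {w}))" for w
      have a: "a w \<in> rat_polyfuns coords" for w
        unfolding a_def by (intro rat_polyfuns_sum rat_polyfuns_mult g(1) rat_polyfuns_ediff_indicator)
      have "(\<Sum>w\<in>V. y w * a w x') = (\<Sum>t\<in>T. g t x' * ediff t (indicator {v}) * ediff t y)"
        unfolding a_def by (rule sum_indicators)
      also have "\<dots> = 0"
        using stress_kernelD[OF y, of "indicator {v}"] by (simp add: \<omega>'_def mult_ac)
      finally have "(\<Sum>w\<in>V. a w x' * y w) = 0" by (simp add: mult.commute)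
      moreover have "\<forall>w\<in>V. a w x' \<in> ?K" using polyvaluesI[OF a] by blast
      ultimately have "(\<Sum>w\<in>V. a w x' * c w l) = 0"
        using rel[rule_format, of "\<lambda>w. a w x'" l] l(1) by blast
      then have "(\<Sum>w\<in>V. h w x' * a w x') = 0" by (simp add: h(2) mult.commute)
      moreover have "(\<lambda>x. \<Sum>w\<in>V. h w x * a w x) \<in> rat_polyfuns coords"
        by (intro rat_polyfuns_sum rat_polyfuns_mult h(1) a)
      ultimately have "(\<Sum>w\<in>V. h w x * a w x) = 0" by (rule_tac vanish')
      moreover have "(\<Sum>w\<in>V. h w x * a w x) = (\<Sum>t\<in>T. g t x * ediff t (indicator {v}) * ediff t (\<lambda>w. h w x))"
        unfolding a_def by (rule sum_indicators)
      ultimately show "(\<Sum>t\<in>T. \<omega> t * ediff t (\<lambda>w. h w x) * ediff t (indicator {v})) = 0"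
        by (simp add: g(2) mult_ac)
    qed
    from ker[OF this] have "h v1 x = 0" using v1(1) h0 by metis
    then have "h v1 x' = 0" using vanish h(1)[OF v1(1)] by blast
    with l(2) h(2)[OF v1(1)] show False by simp
  qed
  ultimately show ?thesis by blast
qed

text \<open>Global rigidity with congruence replaced by translation, tested by coordinates;
  \<open>congruent_frameworks_same_lattice\<close> justifies this for an invertible lattice.\<close>

definition unique_placement :: "('v \<Rightarrow> real ^ 'd) \<Rightarrow> real ^ 'd ^ 'd \<Rightarrow> bool" where
  "unique_placement p L \<longleftrightarrow> (\<forall>q. (\<forall>t\<in>T. edge_length p L t = edge_length q L t) \<longrightarrow>
     (\<forall>i. const_on_V (\<lambda>v. q v $ i - p v $ i)))"

text \<open>Among the polynomial stresses, \<open>generic_stress_exists\<close> selects one on whose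
  kernel all others vanish quadratically. That kernel is nontrivial by assumption, so
  \<open>equivalent_displacement_exists\<close> yields a second placement.\<close>

lemma not_unique_placement:
  assumes gen: "generic_framework V p L"
    and nontrivial: "\<And>\<omega>. polynomial_stress p L \<omega> \<Longrightarrow> \<exists>z. stress_kernel \<omega> z \<and> \<not> const_on_V z"
  shows "\<not> unique_placement p L"
proof -
  define S where "S = {\<omega>. polynomial_stress p L \<omega>}"
  have "polynomial_stress p L (\<lambda>_. 0)"
    using polyvalues_of_rat[of 0 coords "framework_coords p L"]
    by (simp add: polynomial_stress_def stress_def balanced_def)
  then have "S \<noteq> {}" by (auto simp: S_def)
  moreover have "(\<lambda>t. \<omega> t + 1 / real (Suc m) * \<sigma> t) \<in> S" if S: "\<omega> \<in> S" "\<sigma> \<in> S" for \<omega> \<sigma> m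
  proof -
    define r where "r = 1 / real (Suc m)"
    have r: "r \<in> polyvalues coords (framework_coords p L)"
      using polyvalues_of_rat[of "1 / of_nat (Suc m)" coords "framework_coords p L"]
      by (simp add: r_def of_rat_divide of_rat_add)
    have "balanced (\<lambda>t. \<omega> t * evec p L t i + r * (\<sigma> t * evec p L t i))" for i
      using S by (intro balanced_add balanced_scale) (auto simp: S_def polynomial_stress_def stress_def)
    then have "stress p L (\<lambda>t. \<omega> t + r * \<sigma> t)"
      by (simp add: stress_def distrib_right mult.assoc)
    then show ?thesis
      using S r unfolding S_def polynomial_stress_def r_def[symmetric]
      by (blast intro: polyvalues_add polyvalues_mult)
  qed
  ultimately have "\<exists>\<omega>\<in>S. \<forall>\<sigma>\<in>S. \<forall>z. stress_kernel \<omega> z \<longrightarrow> (\<Sum>t\<in>T. \<sigma> t * (ediff t z)\<^sup>2) = 0"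
    by (rule generic_stress_exists)
  then obtain \<omega> where \<omega>: "\<omega> \<in> S"
    "\<And>\<sigma> z. \<sigma> \<in> S \<Longrightarrow> stress_kernel \<omega> z \<Longrightarrow> (\<Sum>t\<in>T. \<sigma> t * (ediff t z)\<^sup>2) = 0"
    by blast
  have pst: "polynomial_stress p L \<omega>" using \<omega>(1) by (simp add: S_def)
  then have st: "stress p L \<omega>" by (simp add: polynomial_stress_def)
  obtain \<kappa> where \<kappa>: "stress_kernel \<omega> \<kappa>" "\<not> const_on_V \<kappa>" using nontrivial[OF pst] by blast
  \<comment> \<open>The selection compares polynomial stresses only; the displacement argument needs
    all real ones.\<close>
  have quad: "(\<Sum>t\<in>T. \<sigma> t * (ediff t y)\<^sup>2) = 0" if "stress p L \<sigma>" "stress_kernel \<omega> y" for \<sigma> y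
    using \<omega>(2)[OF _ that(2)] by (intro stress_quadratic_vanishing[OF _ that(1)]) (simp add: S_def)
  from equivalent_displacement_exists[OF free_placement_if_generic[OF gen] st quad \<kappa>]
  obtain z i where z: "\<not> const_on_V (z i)"
    "\<forall>t\<in>T. 2 * (\<Sum>i\<in>UNIV. evec p L t i * ediff t (z i)) + (\<Sum>i\<in>UNIV. (ediff t (z i))\<^sup>2) = 0"
    by blast
  define q where "q v = p v + (\<chi> i. z i v)" for v
  have ev: "evec q L t i = evec p L t i + ediff t (z i)" for t i
    by (simp add: evec_def q_def ediff_add)
  have "edge_length p L t = edge_length q L t" if "t \<in> T" for t
    using z(2)[rule_format, OF that] unfolding edge_length_eq_iff ev
    by (simp add: power2_sum sum.distrib sum_distrib_left mult.assoc)
  moreover have "q v $ i - p v $ i = z i v" for v by (simp add: q_def)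
  ultimately show ?thesis using z(1) unfolding unique_placement_def by metis
qed

text \<open>A polynomial stress with trivial kernel at one generic framework transfers to all of
  them and gives uniqueness; if there is none anywhere, uniqueness fails at each.\<close>

lemma unique_placement_dichotomy:
  "(\<forall>p L. generic_framework V p L \<longrightarrow> unique_placement p L) \<or>
   (\<forall>p L. generic_framework V p L \<longrightarrow> \<not> unique_placement p L)"
proof (cases "\<exists>p L \<omega>. generic_framework V p L \<and> polynomial_stress p L \<omega> \<and>
    (\<forall>z. stress_kernel \<omega> z \<longrightarrow> const_on_V z)")
  case True
  have "unique_placement p L" if gen: "generic_framework V p L" for p L
  proof -
    obtain \<omega> where "stress p L \<omega>" "\<And>z. stress_kernel \<omega> z \<Longrightarrow> const_on_V z"
      using True trivial_stress_kernel_transfer[OF _ gen] by blast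
    then show ?thesis
      using unique_placement_if_stress_kernel_trivial[OF free_placement_if_generic[OF gen]]
      unfolding unique_placement_def by blast
  qed
  then show ?thesis by blast
next
  case False
  then show ?thesis using not_unique_placement by blast
qed

end

text \<open>A congruence that fixes the lattice satisfies \<open>L = M ** L\<close>; invertibility
  of \<open>L\<close> forces \<open>M\<close> to be the identity, and only a translation
  remains.\<close>

lemma congruent_frameworks_same_lattice:
  fixes p q :: "'v \<Rightarrow> real ^ 'd"
  assumes "det L \<noteq> 0" and v0: "v0 \<in> V"
  shows "congruent_frameworks V p L q L \<longleftrightarrow> (\<forall>i. \<forall>v\<in>V. q v $ i - p v $ i = q v0 $ i - p v0 $ i)"
proof
  assume "congruent_frameworks V p L q L"
  then obtain M x where M: "\<forall>v\<in>V. q v = M *v p v + x" "L = M ** L"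
    unfolding congruent_frameworks_def by blast
  obtain L' where L': "L ** L' = mat 1" using assms(1) invertible_det_nz[of L] by (auto simp: invertible_def)
  have "M = M ** (L ** L')" by (simp add: L')
  also have "\<dots> = (M ** L) ** L'" by (rule matrix_mul_assoc)
  also have "\<dots> = mat 1" by (simp only: M(2)[symmetric] L')
  finally have "q v = p v + x" if "v \<in> V" for v using M(1) that by simp
  then show "\<forall>i. \<forall>v\<in>V. q v $ i - p v $ i = q v0 $ i - p v0 $ i" using v0 by simp
next
  assume "\<forall>i. \<forall>v\<in>V. q v $ i - p v $ i = q v0 $ i - p v0 $ i"
  then have "q v = mat 1 *v p v + (q v0 - p v0)" if "v \<in> V" for v
    using that by (simp add: vec_eq_iff) (metis add.commute diff_add_cancel)
  then show "congruent_frameworks V p L q L"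
    unfolding congruent_frameworks_def
    by (intro exI[of _ "mat 1"] exI[of _ "q v0 - p v0"]) (auto simp: orthogonal_matrix_id)
qed

text \<open>Finiteness holds because an edge class contains at most two triples.\<close>

lemma (in gain_graph) gain_edges_Union:
  assumes "v0 \<in> V"
  shows "gain_edges V (\<Union>E) v0"
proof
  have fin: "finite e" "e \<subseteq> gain_triples V" if e: "e \<in> E" for e
  proof -
    obtain s where s: "e = gain_rel V `` {s}" using edges e by (blast elim: quotientE)
    obtain u v \<gamma> where "s = (u, v, \<gamma>)" by (cases s)
    then have "e \<subseteq> {(u, v, \<gamma>), (v, u, - \<gamma>)}" unfolding s by (auto simp: gain_rel_def)
    then show "finite e" by (rule finite_subset) simp
    show "e \<subseteq> gain_triples V" unfolding s by (auto simp: gain_rel_def gain_triples_def)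
  qed
  show "finite (\<Union>E)" using fin(1) finite_edges by blast
  show "fst t \<in> V \<and> fst (snd t) \<in> V" if "t \<in> \<Union>E" for t
    using fin(2) that by (force simp: gain_triples_def)
qed (use finite_vertices assms in auto)

theorem theorem1p4:
  fixes V :: "'v set" and E :: "('v, 'd::finite) gain_triple set set"
  assumes "gain_graph V E"
  shows "(\<forall>(p :: 'v \<Rightarrow> real ^ 'd) L. generic_framework V p L \<longrightarrow> fixed_lattice_globally_rigid V E p L) \<or>
         (\<forall>(p :: 'v \<Rightarrow> real ^ 'd) L. generic_framework V p L \<longrightarrow> \<not> fixed_lattice_globally_rigid V E p L)"
proof -
  obtain v0 where v0: "v0 \<in> V" using gain_graph.vertices_nonempty[OF assms] by blast
  interpret gain_edges V "\<Union>E" v0 by (rule gain_graph.gain_edges_Union[OF assms v0])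
  have union: "(\<forall>t\<in>\<Union>E. P t) \<longleftrightarrow> (\<forall>e\<in>E. \<forall>t\<in>e. P t)" for P by blast
  have "fixed_lattice_globally_rigid V E p L \<longleftrightarrow> unique_placement p L"
    if "generic_framework V p L" for p :: "'v \<Rightarrow> real ^ 'd" and L
    unfolding fixed_lattice_globally_rigid_def unique_placement_def equivalent_frameworks_def
      congruent_frameworks_same_lattice[OF generic_framework_det_nonzero[OF that] v0] union
    by (rule refl)
  then show ?thesis using unique_placement_dichotomy by metis
qed

end
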